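(* Let $D$ be an integral domain and, for a semistar operation $\star$ on $D$, let $[\star]$ be the semistar operation on $D[X]$ defined in the context. Then $[w_D]=[t_D]=[v_D]=\widetilde{v_{D[X]}}=w_{D[X]}$.
   Context: $D$ has quotient field $K$; $X,Y$ are indeterminates; $D_1:=D[X]$, $K_1:=K(X)$. A semistar operation on a domain $A$ is a map $E\mapsto E^\star$ on nonzero $A$-submodules of the quotient field with $(xE)^\star=xE^\star$, monotone, extensive and idempotent. $E^{\star_f}=\bigcup\{F^\star\mid F\subseteq E,\ F$ nonzero finitely generated$\}$. Quasi-$\star$-ideal: nonzero ideal $I$ with $I^\star\cap A=I$; $\mathrm{QMax}^\star(A)$: maximal proper quasi-$\star$-ideals; $E^{\widetilde\star}=\bigcap\{EA_P\mid P\in\mathrm{QMax}^{\star_f}(A)\}$. $v_A$: $E\mapsto(A:(A:E))$; $t_A:=(v_A)_f$; $w_A:=\widetilde{v_A}$. For a semistar operation $\star$ on $D$: $\boldsymbol\Delta_1^\star:=\{Q_1\in\mathrm{Spec}(D_1)\mid Q_1\cap D=(0),\ \text{or } Q_1=(Q_1\cap D)[X]\text{ and }(Q_1\cap D)^{\star_f}\subsetneq D^\star\}$; $\mathcal S_1^\star:=D_1[Y]\setminus\bigcup\{Q_1[Y]\mid Q_1\in\boldsymbol\Delta_1^\star\}$; $[\star]$ is the semistar operation on $D_1$ given by $E^{[\star]}:=E[Y]_{\mathcal S_1^\star}\cap K_1$, with $E[Y]_{\mathcal S_1^\star}$ the $D_1[Y]_{\mathcal S_1^\star}$-submodule of $K(X,Y)$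 generated by $E$. *)

theory Defs
  imports "HOL-Computational_Algebra.Polynomial" "HOL-Computational_Algebra.Fraction_Field"
begin

section \<open>Generic notions for a subring A of a field 'k (the field is the quotient field of A)\<close>

definition ss_subring :: "'k::field set \<Rightarrow> bool" where
  "ss_subring A \<longleftrightarrow> 0 \<in> A \<and> 1 \<in> A \<and> (\<forall>x\<in>A. \<forall>y\<in>A. x + y \<in> A \<and> x - y \<in> A \<and> x * y \<in> A)"

definition ss_submod :: "'k::field set \<Rightarrow> 'k set \<Rightarrow> bool" where
  "ss_submod A E \<longleftrightarrow> 0 \<in> E \<and> (\<forall>x\<in>E. \<forall>y\<in>E. x + y \<in> E) \<and> (\<forall>a\<in>A. \<forall>x\<in>E. a * x \<in> E)"

definition ss_nzmod :: "'k::field set \<Rightarrow> 'k set \<Rightarrow> bool" where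
  "ss_nzmod A E \<longleftrightarrow> ss_submod A E \<and> E \<noteq> {0}"

inductive_set ss_span :: "'k::field set \<Rightarrow> 'k set \<Rightarrow> 'k set" for R E where
  zero: "0 \<in> ss_span R E"
| base: "e \<in> E \<Longrightarrow> e \<in> ss_span R E"
| smult: "r \<in> R \<Longrightarrow> x \<in> ss_span R E \<Longrightarrow> r * x \<in> ss_span R E"
| add: "x \<in> ss_span R E \<Longrightarrow> y \<in> ss_span R E \<Longrightarrow> x + y \<in> ss_span R E"

definition ss_nzfg :: "'k::field set \<Rightarrow> 'k set \<Rightarrow> bool" where
  "ss_nzfg A F \<longleftrightarrow> (\<exists>S. finite S \<and> F = ss_span A S) \<and> F \<noteq> {0}"

definition ss_finite_type :: "'k::field set \<Rightarrow> ('k set \<Rightarrow> 'k set) \<Rightarrow> 'k set \<Rightarrow> 'k set" where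
  "ss_finite_type A st E = \<Union>{st F | F. F \<subseteq> E \<and> ss_nzfg A F}"

definition ss_ideal :: "'k::field set \<Rightarrow> 'k set \<Rightarrow> bool" where
  "ss_ideal A I \<longleftrightarrow> I \<subseteq> A \<and> ss_submod A I"

definition ss_prime :: "'k::field set \<Rightarrow> 'k set \<Rightarrow> bool" where
  "ss_prime A P \<longleftrightarrow> ss_ideal A P \<and> P \<noteq> A \<and> (\<forall>a\<in>A. \<forall>b\<in>A. a * b \<in> P \<longrightarrow> a \<in> P \<or> b \<in> P)"

definition ss_quasi :: "'k::field set \<Rightarrow> ('k set \<Rightarrow> 'k set) \<Rightarrow> 'k set \<Rightarrow> bool" where
  "ss_quasi A st I \<longleftrightarrow> ss_ideal A I \<and> I \<noteq> {0} \<and> st I \<inter> A = I"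

definition ss_QMax :: "'k::field set \<Rightarrow> ('k set \<Rightarrow> 'k set) \<Rightarrow> 'k set set" where
  "ss_QMax A st = {P. ss_quasi A st P \<and> P \<noteq> A \<and>
      (\<forall>Q. ss_quasi A st Q \<and> Q \<noteq> A \<and> P \<subseteq> Q \<longrightarrow> Q = P)}"

definition ss_loc :: "'k::field set \<Rightarrow> 'k set \<Rightarrow> 'k set" where
  "ss_loc A P = {a / s | a s. a \<in> A \<and> s \<in> A \<and> s \<notin> P}"

definition ss_tilde :: "'k::field set \<Rightarrow> ('k set \<Rightarrow> 'k set) \<Rightarrow> 'k set \<Rightarrow> 'k set" where
  "ss_tilde A st E = \<Inter>{ss_span (ss_loc A P) E | P. P \<in> ss_QMax A (ss_finite_type A st)}"

definition ss_colon :: "'k::field set \<Rightarrow> 'k set \<Rightarrow> 'k set" where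
  "ss_colon A E = {x. \<forall>e\<in>E. x * e \<in> A}"

definition ss_v :: "'k::field set \<Rightarrow> 'k set \<Rightarrow> 'k set" where
  "ss_v A E = ss_colon A (ss_colon A E)"

definition ss_t :: "'k::field set \<Rightarrow> 'k set \<Rightarrow> 'k set" where
  "ss_t A = ss_finite_type A (ss_v A)"

definition ss_w :: "'k::field set \<Rightarrow> 'k set \<Rightarrow> 'k set" where
  "ss_w A = ss_tilde A (ss_v A)"

section \<open>D[X] inside K(X) = 'a poly fract, and D[X][Y] inside K(X,Y) = 'a poly fract poly fract\<close>

definition DX :: "'a::field set \<Rightarrow> 'a poly fract set" where
  "DX D = {Fract p 1 | p. \<forall>i. coeff p i \<in> D}"

definition ext_X :: "'a::field set \<Rightarrow> 'a poly fract set" where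
  "ext_X P = {Fract p 1 | p. \<forall>i. coeff p i \<in> P}"

definition contr_D :: "'a::field set \<Rightarrow> 'a poly fract set \<Rightarrow> 'a set" where
  "contr_D D Q = {d \<in> D. Fract [:d:] 1 \<in> Q}"

definition ext_Y :: "'a::field poly fract set \<Rightarrow> 'a poly fract poly fract set" where
  "ext_Y Q = {Fract q 1 | q. \<forall>i. coeff q i \<in> Q}"

definition emb_Y :: "'a::field poly fract \<Rightarrow> 'a poly fract poly fract" where
  "emb_Y x = Fract [:x:] 1"

definition Delta1 :: "'a::field set \<Rightarrow> ('a set \<Rightarrow> 'a set) \<Rightarrow> 'a poly fract set set" where
  "Delta1 D st = {Q. ss_prime (DX D) Q \<and>
      (contr_D D Q = {0} \<or>
       (Q = ext_X (contr_D D Q) \<and> ss_finite_type D st (contr_D D Q) \<subset> st D))}"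

definition S1 :: "'a::field set \<Rightarrow> ('a set \<Rightarrow> 'a set) \<Rightarrow> 'a poly fract poly fract set" where
  "S1 D st = ext_Y (DX D) - \<Union>{ext_Y Q | Q. Q \<in> Delta1 D st}"

definition R1 :: "'a::field set \<Rightarrow> ('a set \<Rightarrow> 'a set) \<Rightarrow> 'a poly fract poly fract set" where
  "R1 D st = {f / s | f s. f \<in> ext_Y (DX D) \<and> s \<in> S1 D st}"

definition bracket :: "'a::field set \<Rightarrow> ('a set \<Rightarrow> 'a set) \<Rightarrow> 'a poly fract set \<Rightarrow> 'a poly fract set" where
  "bracket D st E = {x. emb_Y x \<in> ss_span (R1 D st) (emb_Y ` E)}"

end

theory Submission
  imports Defs "HOL-Computational_Algebra.Polynomial_Factorial"
begin

text \<open>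
  Call a finite subset \<open>J\<close> of a domain \<open>A\<close> a GV set if \<open>(A : J) = A\<close>. By Zorn's lemma an ideal
  containing no GV set lies in a maximal \<open>t\<close>-ideal, and these are prime. Hence \<open>x \<in> E\<^sup>w\<close> iff
  \<open>Jx \<subseteq> E\<close> for some GV set \<open>J\<close>, and for \<open>\<star> \<in> {v, t, w}\<close> the condition on a prime \<open>P\<close> of \<open>D\<close>
  in the definition of \<open>\<Delta>\<^sub>1\<close> just says that \<open>P\<close> contains no GV set; so the three sets \<open>\<Delta>\<^sub>1\<close> agree.
  Clearing denominators, \<open>x \<in> E\<^bsup>[\<star>]\<^esup>\<close> iff \<open>Jx \<subseteq> E\<close> for some finite \<open>J \<subseteq> D[X]\<close> contained in no
  member of \<open>\<Delta>\<^sub>1\<close> (take for \<open>J\<close> the coefficients of a common denominator). It remains to see that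
  these \<open>J\<close> are exactly the GV sets of \<open>D[X]\<close>.

  A GV set of \<open>D[X]\<close> lies neither in a prime contracting to \<open>0\<close>, whose extension to \<open>K[X]\<close> is
  generated by a nonconstant polynomial, nor in some \<open>P[X]\<close> with \<open>P\<close> free of GV sets.
  Conversely, let \<open>J\<close> lie in no member of \<open>\<Delta>\<^sub>1\<close> and \<open>uJ \<subseteq> D[X]\<close>. A prime factor of the reduced
  denominator of \<open>u\<close> would divide all of \<open>J\<close>, so \<open>u \<in> K[X]\<close>. The coefficients of \<open>J\<close> form a GV
  set of \<open>D\<close>, and a power of each of them multiplies \<open>u\<close> into \<open>D[X]\<close>, which forces \<open>u \<in> D[X]\<close>.
\<close>

section \<open>GV sets and maximal t-ideals\<close>

text \<open>Generating sets of Glaz--Vasconcelos ideals, i.e. of the finitely generated ideals with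
  trivial \<open>v\<close>-closure. The condition \<open>\<not> J \<subseteq> {0}\<close> matters only if \<open>A\<close> is the whole field.\<close>

definition gv_set :: "'k::field set \<Rightarrow> 'k set \<Rightarrow> bool" where
  "gv_set A J \<longleftrightarrow> finite J \<and> J \<subseteq> A \<and> \<not> J \<subseteq> {0} \<and> ss_colon A J \<subseteq> A"

text \<open>For an ideal \<open>I\<close> of a subring \<open>A\<close> this says that the t-closure
  of \<open>I\<close> misses \<open>1\<close>. Finiteness of GV sets makes the property stable under
  unions of chains.\<close>

definition gv_free :: "'k::field set \<Rightarrow> 'k set \<Rightarrow> bool" where
  "gv_free A I \<longleftrightarrow> (\<forall>J\<subseteq>I. \<not> gv_set A J)"

section \<open>Spans, colons and finite-type closures\<close>

lemma ss_span_least: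
  assumes "ss_submod A E" "S \<subseteq> E"
  shows "ss_span A S \<subseteq> E"
proof
  fix x assume "x \<in> ss_span A S"
  then show "x \<in> E"
    by induction (use assms in \<open>auto simp: ss_submod_def\<close>)
qed

lemma ss_submod_span: "ss_submod A (ss_span A S)"
  by (auto simp: ss_submod_def intro: ss_span.intros)

lemma ss_span_superset: "S \<subseteq> ss_span A S"
  by (auto intro: ss_span.intros)

lemma ss_span_mono: "S \<subseteq> T \<Longrightarrow> ss_span A S \<subseteq> ss_span A T"
  by (meson ss_span_least ss_submod_span ss_span_superset order_trans)

lemma ss_span_sum:
  "(\<And>i. i \<in> I \<Longrightarrow> f i \<in> ss_span R E) \<Longrightarrow> (\<Sum>i\<in>I. f i) \<in> ss_span R E"
  by (induction I rule: infinite_finite_induct) (auto intro: ss_span.intros)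

lemma ss_colon_antimono: "E \<subseteq> F \<Longrightarrow> ss_colon A F \<subseteq> ss_colon A E"
  by (auto simp: ss_colon_def)

lemma ss_v_mono: "E \<subseteq> F \<Longrightarrow> ss_v A E \<subseteq> ss_v A F"
  by (simp add: ss_v_def ss_colon_antimono)

lemma ss_v_superset: "E \<subseteq> ss_v A E"
  by (auto simp: ss_v_def ss_colon_def mult.commute)

text \<open>The colon forms an antitone Galois connection with itself, so a triple colon collapses
  to a single one.\<close>

lemma ss_colon_v: "ss_colon A (ss_v A E) = ss_colon A E"
proof
  show "ss_colon A (ss_v A E) \<subseteq> ss_colon A E"
    by (rule ss_colon_antimono[OF ss_v_superset])
  show "ss_colon A E \<subseteq> ss_colon A (ss_v A E)"
    by (auto simp: ss_v_def ss_colon_def mult.commute)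
qed

lemma ss_finite_type_iff:
  "x \<in> ss_finite_type A st E \<longleftrightarrow> (\<exists>F. F \<subseteq> E \<and> ss_nzfg A F \<and> x \<in> st F)"
  by (auto simp: ss_finite_type_def)

text \<open>A witness inside \<open>F\<close> lies in \<open>E\<close> whenever \<open>F\<close>
  does, and a finitely generated \<open>F\<close> witnesses its own closure. So passing to finite
  type twice changes nothing, which reduces the t-case of \<open>Delta1\<close> to the
  v-case.\<close>

lemma ss_finite_type_t: "ss_finite_type A (ss_t A) E = ss_finite_type A (ss_v A) E"
proof
  show "ss_finite_type A (ss_t A) E \<subseteq> ss_finite_type A (ss_v A) E"
    unfolding ss_t_def ss_finite_type_def by (auto; blast dest: order_trans)
  show "ss_finite_type A (ss_v A) E \<subseteq> ss_finite_type A (ss_t A) E"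
    unfolding ss_t_def ss_finite_type_def by blast
qed

context
  fixes A :: "'k::field set"
  assumes A: "ss_subring A"
begin

lemma subring_closed:
  "0 \<in> A" "1 \<in> A" "x \<in> A \<Longrightarrow> y \<in> A \<Longrightarrow> x + y \<in> A"
  "x \<in> A \<Longrightarrow> y \<in> A \<Longrightarrow> x - y \<in> A" "x \<in> A \<Longrightarrow> y \<in> A \<Longrightarrow> x * y \<in> A"
  using A by (auto simp: ss_subring_def)

lemma subring_uminus: "x \<in> A \<Longrightarrow> - x \<in> A"
  using subring_closed(1) subring_closed(4)[of 0 x] by simp

lemma subring_power: "x \<in> A \<Longrightarrow> x ^ n \<in> A"
  by (induction n) (auto intro: subring_closed)

lemma ss_ideal_self: "ss_ideal A A"
  using subring_closed by (auto simp: ss_ideal_def ss_submod_def)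

lemma ss_colon_self: "ss_colon A A = A"
  using subring_closed by (force simp: ss_colon_def)

lemma ss_v_self: "ss_v A A = A"
  by (simp add: ss_v_def ss_colon_self)

lemma ss_submod_colon: "ss_submod A (ss_colon A E)"
  using subring_closed
  by (auto simp: ss_submod_def ss_colon_def distrib_right mult.assoc)

text \<open>For fixed \<open>x\<close>, the \<open>y\<close> with \<open>x * y\<close> in
  \<open>A\<close> form a submodule. This is what allows finite sets to replace finitely generated
  modules in \<open>gv_set\<close>.\<close>

lemma ss_colon_span: "ss_colon A (ss_span A S) = ss_colon A S"
proof
  show "ss_colon A (ss_span A S) \<subseteq> ss_colon A S"
    by (rule ss_colon_antimono[OF ss_span_superset])
  have "x * y \<in> A" if "x \<in> ss_colon A S" "y \<in> ss_span A S" for x y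
    using that(2)
  proof induction
    case (smult r z)
    then show ?case
      using subring_closed(5)[of r "x * z"] by (simp add: mult.left_commute)
  qed (use that(1) in \<open>auto simp: ss_colon_def distrib_left intro: subring_closed\<close>)
  then show "ss_colon A S \<subseteq> ss_colon A (ss_span A S)"
    by (auto simp: ss_colon_def)
qed

lemma span_one: "ss_span A {1} = A"
proof
  show "ss_span A {1} \<subseteq> A"
    using ss_ideal_self subring_closed by (intro ss_span_least) (auto simp: ss_ideal_def)
  show "A \<subseteq> ss_span A {1}"
  proof
    fix a assume "a \<in> A"
    then show "a \<in> ss_span A {1}"
      using ss_span.smult[OF _ ss_span.base, of a A 1 "{1}"] by simp
  qed
qed

lemma nzfg_self: "ss_nzfg A A"
proof -
  have "A \<noteq> {0}" using subring_closed(2) by auto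
  then show ?thesis
    unfolding ss_nzfg_def using span_one by (metis finite.emptyI finite.insertI)
qed

lemma gv_setD: "gv_set A J \<Longrightarrow> ss_v A J = A"
proof -
  assume J: "gv_set A J"
  have "A \<subseteq> ss_colon A J"
    using J by (auto simp: gv_set_def ss_colon_def intro: subring_closed)
  with J have "ss_colon A J = A" by (auto simp: gv_set_def)
  then show ?thesis by (simp add: ss_v_def ss_colon_self)
qed

lemma nzfg_span: "finite J \<Longrightarrow> \<not> J \<subseteq> {0} \<Longrightarrow> ss_nzfg A (ss_span A J)"
  unfolding ss_nzfg_def using ss_span_superset[of J A] by blast

lemma ss_v_span: "ss_v A (ss_span A J) = ss_v A J"
  by (simp add: ss_v_def ss_colon_span)

lemma nzfgE:
  assumes "ss_nzfg A F"
  obtains S where "finite S" "\<not> S \<subseteq> {0}" "F = ss_span A S"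
proof -
  obtain S where S: "finite S" "F = ss_span A S" "F \<noteq> {0}"
    using assms by (auto simp: ss_nzfg_def)
  have "\<not> S \<subseteq> {0}"
  proof
    assume "S \<subseteq> {0}"
    then have "F \<subseteq> {0}"
      unfolding S(2) by (intro ss_span_least) (auto simp: ss_submod_def)
    with S show False using ss_span.zero by blast
  qed
  with S that show ?thesis by blast
qed

lemma nzfg_Un:
  assumes "ss_nzfg A F" "ss_nzfg A G" "ss_submod A E" "F \<subseteq> E" "G \<subseteq> E"
  obtains H where "ss_nzfg A H" "F \<subseteq> H" "G \<subseteq> H" "H \<subseteq> E"
proof -
  obtain S T where ST: "finite S" "\<not> S \<subseteq> {0}" "F = ss_span A S" "finite T" "G = ss_span A T"
    using assms(1,2) by (metis nzfgE)
  show ?thesis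
  proof (rule that)
    show "ss_nzfg A (ss_span A (S \<union> T))" using ST by (intro nzfg_span) auto
    show "F \<subseteq> ss_span A (S \<union> T)" "G \<subseteq> ss_span A (S \<union> T)"
      unfolding ST by (auto intro!: ss_span_mono)
    show "ss_span A (S \<union> T) \<subseteq> E"
      using ss_span_superset[of S A] ss_span_superset[of T A] ST assms(3-5)
      by (intro ss_span_least) auto
  qed
qed

text \<open>If \<open>1\<close> lies in the v-closure of \<open>F\<close>, every multiplier of
  \<open>F\<close> into \<open>A\<close> is itself in \<open>A\<close>, so a finite generating set
  of \<open>F\<close> is a GV set. Conversely, a GV set spans a module with v-closure
  \<open>A\<close>.\<close>

lemma one_in_finite_type_v_iff:
  assumes "ss_submod A I" "I \<subseteq> A"
  shows "1 \<in> ss_finite_type A (ss_v A) I \<longleftrightarrow> \<not> gv_free A I"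
proof
  assume "1 \<in> ss_finite_type A (ss_v A) I"
  then obtain F where F: "F \<subseteq> I" "ss_nzfg A F" "1 \<in> ss_v A F"
    unfolding ss_finite_type_def by blast
  then obtain S where S: "finite S" "\<not> S \<subseteq> {0}" "F = ss_span A S" by (metis nzfgE)
  have "S \<subseteq> I" using S F ss_span_superset by blast
  moreover have "ss_colon A S \<subseteq> A"
    using F(3) unfolding S(3) ss_v_span by (auto simp: ss_v_def ss_colon_def)
  ultimately show "\<not> gv_free A I"
    using S assms unfolding gv_free_def gv_set_def by blast
next
  assume "\<not> gv_free A I"
  then obtain J where J: "J \<subseteq> I" "gv_set A J" by (auto simp: gv_free_def)
  have "ss_nzfg A (ss_span A J)" using J by (intro nzfg_span) (auto simp: gv_set_def)
  moreover have "ss_span A J \<subseteq> I" using J assms by (intro ss_span_least)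
  moreover have "1 \<in> ss_v A (ss_span A J)"
    using gv_setD[OF J(2)] subring_closed by (simp add: ss_v_span)
  ultimately show "1 \<in> ss_finite_type A (ss_v A) I" by (auto simp: ss_finite_type_iff)
qed

lemma finite_type_v_subset:
  assumes "I \<subseteq> A"
  shows "ss_finite_type A (ss_v A) I \<subseteq> A"
proof
  fix x assume "x \<in> ss_finite_type A (ss_v A) I"
  then obtain F where "F \<subseteq> I" "x \<in> ss_v A F" by (auto simp: ss_finite_type_iff)
  then show "x \<in> A" using ss_v_mono[of F A A] ss_v_self assms by auto
qed

lemma ideal_eq_self_iff: "ss_ideal A I \<Longrightarrow> I = A \<longleftrightarrow> 1 \<in> I"
  using subring_closed(2) by (auto simp: ss_ideal_def ss_submod_def) (metis mult.right_neutral)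

section \<open>Maximal t-ideals and ideals free of GV sets\<close>

lemma quasi_gv_free:
  assumes "ss_quasi A (ss_finite_type A (ss_v A)) P" "P \<noteq> A"
  shows "gv_free A P"
proof (rule ccontr)
  assume "\<not> gv_free A P"
  with assms have "1 \<in> ss_finite_type A (ss_v A) P"
    by (subst one_in_finite_type_v_iff) (auto simp: ss_quasi_def ss_ideal_def)
  with assms have "1 \<in> P" using subring_closed by (auto simp: ss_quasi_def)
  with assms show False using ideal_eq_self_iff by (auto simp: ss_quasi_def)
qed

lemma submod_finite_type_v:
  assumes I: "ss_submod A I" "I \<noteq> {0}"
  shows "ss_submod A (ss_finite_type A (ss_v A) I)" and "I \<subseteq> ss_finite_type A (ss_v A) I"
proof -
  let ?T = "ss_finite_type A (ss_v A) I"
  have sub: "a \<in> ?T" if "a \<in> I" "a \<noteq> 0" for a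
  proof -
    have "ss_nzfg A (ss_span A {a})" using that by (intro nzfg_span) auto
    moreover have "ss_span A {a} \<subseteq> I" using that I by (intro ss_span_least) auto
    moreover have "a \<in> ss_v A (ss_span A {a})"
      using ss_v_superset ss_span_superset by blast
    ultimately show ?thesis by (auto simp: ss_finite_type_iff)
  qed
  have v: "ss_submod A (ss_v A F)" for F by (simp add: ss_v_def ss_submod_colon)
  \<comment> \<open>The union defining the closure ranges over nonzero modules only, so
    \<open>0\<close> enters through the v-closure of one of them.\<close>
  obtain a where "a \<in> I" "a \<noteq> 0" using I by (auto simp: ss_submod_def)
  from sub[OF this] have zero: "0 \<in> ?T"
    using v by (auto simp: ss_finite_type_iff ss_submod_def)
  with sub show "I \<subseteq> ?T" by blast
  have "x + y \<in> ?T" if "x \<in> ?T" "y \<in> ?T" for x y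
  proof -
    obtain F where F: "x \<in> ss_v A F" "F \<subseteq> I" "ss_nzfg A F"
      using \<open>x \<in> ?T\<close> by (auto simp: ss_finite_type_iff)
    obtain G where G: "y \<in> ss_v A G" "G \<subseteq> I" "ss_nzfg A G"
      using \<open>y \<in> ?T\<close> by (auto simp: ss_finite_type_iff)
    note FG = F G
    obtain H where H: "ss_nzfg A H" "F \<subseteq> H" "G \<subseteq> H" "H \<subseteq> I"
      using nzfg_Un FG I by metis
    have "x + y \<in> ss_v A H"
      using FG H v[of H] ss_v_mono[of F H A] ss_v_mono[of G H A] unfolding ss_submod_def by blast
    with H show ?thesis by (auto simp: ss_finite_type_iff)
  qed
  moreover have "a * x \<in> ?T" if "a \<in> A" "x \<in> ?T" for a x
  proof -
    obtain F where "F \<subseteq> I" "ss_nzfg A F" "x \<in> ss_v A F"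
      using \<open>x \<in> ?T\<close> by (auto simp: ss_finite_type_iff)
    then show ?thesis using \<open>a \<in> A\<close> v[of F] by (auto simp: ss_finite_type_iff ss_submod_def)
  qed
  ultimately show "ss_submod A ?T" using zero by (auto simp: ss_submod_def)
qed

text \<open>Finitely many witnesses sit in one finitely generated submodule of \<open>I\<close>,
  since sums of such modules are of the same kind and \<open>ss_v\<close> is monotone.\<close>

lemma finite_subset_finite_type_v:
  assumes I: "ss_submod A I" "I \<noteq> {0}" and G: "finite G" "G \<subseteq> ss_finite_type A (ss_v A) I"
  shows "\<exists>F. ss_nzfg A F \<and> F \<subseteq> I \<and> G \<subseteq> ss_v A F"
  using G
proof (induction G)
  case empty
  obtain a where a: "a \<in> I" "a \<noteq> 0" using I by (auto simp: ss_submod_def)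
  have "ss_nzfg A (ss_span A {a})" using a by (intro nzfg_span) auto
  moreover have "ss_span A {a} \<subseteq> I" using a I by (intro ss_span_least) auto
  ultimately show ?case by blast
next
  case (insert g G)
  then obtain F where F: "ss_nzfg A F" "F \<subseteq> I" "G \<subseteq> ss_v A F" by auto
  obtain F' where F': "ss_nzfg A F'" "F' \<subseteq> I" "g \<in> ss_v A F'"
    using insert by (auto simp: ss_finite_type_iff)
  obtain H where H: "ss_nzfg A H" "F \<subseteq> H" "F' \<subseteq> H" "H \<subseteq> I"
    using nzfg_Un F F' I by metis
  then have "insert g G \<subseteq> ss_v A H"
    using F F' ss_v_mono[of F H A] ss_v_mono[of F' H A] by auto
  with H show ?case by blast
qed

text \<open>A GV set \<open>G\<close> in the t-closure lies in the v-closure of a module spanned by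
  a finite \<open>S\<close> inside \<open>I\<close>. Then \<open>(A : S)\<close>, which equals the
  colon of that v-closure, is contained in \<open>(A : G)\<close> and hence in \<open>A\<close>, so
  \<open>S\<close> would be a GV set in \<open>I\<close>.\<close>

lemma gv_free_t_closure:
  assumes I: "ss_ideal A I" "I \<noteq> {0}" "gv_free A I"
  shows "gv_free A (ss_finite_type A (ss_v A) I)"
proof -
  have "\<not> gv_set A G" if G: "G \<subseteq> ss_finite_type A (ss_v A) I" for G
  proof
    assume gv: "gv_set A G"
    have sI: "ss_submod A I" "I \<subseteq> A" using I by (auto simp: ss_ideal_def)
    obtain F where F: "ss_nzfg A F" "F \<subseteq> I" "G \<subseteq> ss_v A F"
      using finite_subset_finite_type_v[OF sI(1) I(2) _ G] gv by (auto simp: gv_set_def)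
    obtain S where S: "finite S" "\<not> S \<subseteq> {0}" "F = ss_span A S" using F by (metis nzfgE)
    have "ss_colon A S \<subseteq> ss_colon A G"
      using ss_colon_antimono[OF F(3), of A] S by (simp add: ss_colon_v ss_colon_span)
    moreover have "S \<subseteq> I" using S F ss_span_superset by blast
    ultimately have "gv_set A S" using S gv sI unfolding gv_set_def by blast
    with I(3) \<open>S \<subseteq> I\<close> show False by (auto simp: gv_free_def)
  qed
  then show ?thesis by (simp add: gv_free_def)
qed

text \<open>Zorn's lemma provides an ideal \<open>M\<close> above \<open>I\<close> that is maximal
  among those free of GV sets. Its t-closure is again free of GV sets, so \<open>M\<close> is
  t-closed; since every proper quasi-t-ideal above \<open>M\<close> is also free of GV sets,
  \<open>M\<close> is maximal among them.\<close>

lemma gv_free_imp_subset_QMax: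
  assumes I: "ss_ideal A I" "I \<noteq> {0}" "gv_free A I"
  shows "\<exists>P\<in>ss_QMax A (ss_finite_type A (ss_v A)). I \<subseteq> P"
proof -
  define \<F> where "\<F> = {M. ss_ideal A M \<and> I \<subseteq> M \<and> gv_free A M}"
  have "I \<in> \<F>" using I by (auto simp: \<F>_def)
  moreover have "\<Union>\<C> \<in> \<F>" if C: "\<C> \<noteq> {}" "subset.chain \<F> \<C>" for \<C>
  proof -
    have chain: "\<And>M. M \<in> \<C> \<Longrightarrow> M \<in> \<F>" "\<And>M N. M \<in> \<C> \<Longrightarrow> N \<in> \<C> \<Longrightarrow> M \<subseteq> N \<or> N \<subseteq> M"
      using C(2) by (auto simp: subset.chain_def)
    have "x + y \<in> \<Union>\<C>" if xy: "x \<in> \<Union>\<C>" "y \<in> \<Union>\<C>" for x y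
    proof -
      obtain M N where MN: "x \<in> M" "M \<in> \<C>" "y \<in> N" "N \<in> \<C>" using xy by auto
      obtain L where "x \<in> L" "y \<in> L" "L \<in> \<C>"
        using chain(2)[OF MN(2,4)] MN by blast
      then show ?thesis using chain(1)[of L] by (auto simp: \<F>_def ss_ideal_def ss_submod_def)
    qed
    moreover have mem: "M \<subseteq> A" "I \<subseteq> M" "0 \<in> M" "\<And>a x. a \<in> A \<Longrightarrow> x \<in> M \<Longrightarrow> a * x \<in> M"
      if "M \<in> \<C>" for M
      using chain(1)[OF that] by (auto simp: \<F>_def ss_ideal_def ss_submod_def)
    moreover obtain M\<^sub>0 where "M\<^sub>0 \<in> \<C>" using C(1) by blast
    then have "0 \<in> \<Union>\<C>" "I \<subseteq> \<Union>\<C>" using mem by blast+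
    moreover have "\<Union>\<C> \<subseteq> A" using mem by blast
    moreover have "a * x \<in> \<Union>\<C>" if "a \<in> A" "x \<in> \<Union>\<C>" for a x
      using that mem(4) by blast
    moreover have "gv_free A (\<Union>\<C>)"
      unfolding gv_free_def
    proof (intro allI impI notI)
      fix J assume J: "J \<subseteq> \<Union>\<C>" "gv_set A J"
      then have "finite J" by (simp add: gv_set_def)
      \<comment> \<open>A finite subset of the union of a chain already lies in one member.\<close>
      then obtain M where "M \<in> \<C>" "J \<subseteq> M"
        using finite_subset_Union_chain[OF _ J(1) C(1)] C(2) by blast
      then show False using chain(1) J by (auto simp: \<F>_def gv_free_def)
    qed
    ultimately have "ss_ideal A (\<Union>\<C>)" "I \<subseteq> \<Union>\<C>" "gv_free A (\<Union>\<C>)"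
      by (auto simp only: ss_ideal_def ss_submod_def)
    then show ?thesis by (simp add: \<F>_def)
  qed
  ultimately obtain M where M: "M \<in> \<F>" "\<And>N. N \<in> \<F> \<Longrightarrow> M \<subseteq> N \<Longrightarrow> N = M"
    using subset_Zorn_nonempty[of \<F>] by blast
  have MI: "ss_ideal A M" "I \<subseteq> M" "gv_free A M" using M by (auto simp: \<F>_def)
  have M0: "M \<noteq> {0}" using I MI by (auto simp: ss_ideal_def ss_submod_def)
  let ?T = "ss_finite_type A (ss_v A) M"
  have "M \<subseteq> A" "ss_submod A M" using MI by (auto simp: ss_ideal_def)
  note T = submod_finite_type_v[OF this(2) M0] finite_type_v_subset[OF this(1)]
  have "?T \<in> \<F>"
    using T gv_free_t_closure[OF MI(1) M0 MI(3)] MI(2) by (auto simp: \<F>_def ss_ideal_def)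
  then have TM: "?T = M" using M T by blast
  have one: "1 \<notin> M"
    using one_in_finite_type_v_iff[of M] MI TM by (auto simp: ss_ideal_def)
  have "M \<in> ss_QMax A (ss_finite_type A (ss_v A))"
  proof -
    have "ss_quasi A (ss_finite_type A (ss_v A)) M"
      using MI M0 TM by (auto simp: ss_quasi_def ss_ideal_def)
    moreover have "M \<noteq> A" using one subring_closed by auto
    moreover have "Q = M" if "ss_quasi A (ss_finite_type A (ss_v A)) Q" "Q \<noteq> A" "M \<subseteq> Q" for Q
      using quasi_gv_free[OF that(1,2)] that MI(2)
      by (intro M(2)) (auto simp: \<F>_def ss_quasi_def)
    ultimately show ?thesis by (auto simp: ss_QMax_def)
  qed
  with MI show ?thesis by blast
qed

text \<open>If \<open>x\<close> carries all products \<open>f * g\<close> into \<open>A\<close>,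
  then each \<open>x * f\<close> lies in \<open>(A : G)\<close> and so in \<open>A\<close>; hence
  \<open>x\<close> lies in \<open>(A : F)\<close> and so in \<open>A\<close>.\<close>

lemma gv_set_mult:
  assumes "gv_set A F" "gv_set A G"
  shows "gv_set A ((\<lambda>(f, g). f * g) ` (F \<times> G))"
proof -
  have "x \<in> A" if x: "\<And>f g. f \<in> F \<Longrightarrow> g \<in> G \<Longrightarrow> x * (f * g) \<in> A" for x
  proof -
    have "x * f \<in> A" if "f \<in> F" for f
    proof -
      have "x * f \<in> ss_colon A G" using x[OF that] by (simp add: ss_colon_def mult.assoc)
      then show ?thesis using assms(2) by (auto simp: gv_set_def)
    qed
    then show ?thesis using assms(1) by (auto simp: gv_set_def ss_colon_def)
  qed
  then have "ss_colon A ((\<lambda>(f, g). f * g) ` (F \<times> G)) \<subseteq> A"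
    by (auto simp: ss_colon_def)
  moreover have "\<exists>f\<in>F. \<exists>g\<in>G. f * g \<noteq> 0"
  proof -
    obtain f g where "f \<in> F" "f \<noteq> 0" "g \<in> G" "g \<noteq> 0"
      using assms unfolding gv_set_def by blast
    then show ?thesis by auto
  qed
  then have "\<not> (\<lambda>(f, g). f * g) ` (F \<times> G) \<subseteq> {0}" by auto
  moreover have "(\<lambda>(f, g). f * g) ` (F \<times> G) \<subseteq> A"
    using assms by (auto simp: gv_set_def intro!: subring_closed)
  ultimately show ?thesis
    using assms by (simp add: gv_set_def)
qed

text \<open>By maximality, adjoining to \<open>P\<close> an element outside it creates an ideal
  containing a GV set. If \<open>a\<close> and \<open>b\<close> lie outside \<open>P\<close> but
  \<open>a * b\<close> lies in it, the products of two such GV sets form a GV set inside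
  \<open>P\<close>, which is impossible.\<close>

lemma QMax_t_prime:
  assumes P: "P \<in> ss_QMax A (ss_finite_type A (ss_v A))"
  shows "ss_prime A P" "gv_free A P"
proof -
  have id: "ss_ideal A P" "P \<noteq> {0}" "P \<noteq> A" using P by (auto simp: ss_QMax_def ss_quasi_def)
  show free: "gv_free A P" using P quasi_gv_free by (auto simp: ss_QMax_def)
  have clo: "0 \<in> P" "\<And>x y. x \<in> P \<Longrightarrow> y \<in> P \<Longrightarrow> x + y \<in> P"
      "\<And>a x. a \<in> A \<Longrightarrow> x \<in> P \<Longrightarrow> a * x \<in> P" "P \<subseteq> A"
    using id by (auto simp: ss_ideal_def ss_submod_def)
  have ex: "\<exists>F. gv_set A F \<and> (\<forall>f\<in>F. \<exists>p\<in>P. \<exists>c\<in>A. f = p + a * c)"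
    if a: "a \<in> A" "a \<notin> P" for a
  proof (rule ccontr)
    let ?I = "{p + a * c | p c. p \<in> P \<and> c \<in> A}"
    assume no: "\<not> ?thesis"
    have sub: "P \<subseteq> ?I"
    proof
      fix p assume "p \<in> P"
      moreover have "p = p + a * 0" by simp
      ultimately show "p \<in> ?I" using subring_closed(1) by blast
    qed
    have "a = 0 + a * 1" by simp
    then have aI: "a \<in> ?I" using clo(1) subring_closed(2) by blast
    have "ss_ideal A ?I"
      unfolding ss_ideal_def ss_submod_def
    proof (intro conjI ballI)
      show "?I \<subseteq> A" using clo a subring_closed by auto
      show "0 \<in> ?I" using sub clo by blast
      fix x assume "x \<in> ?I"
      then obtain p c where x: "x = p + a * c" "p \<in> P" "c \<in> A" by blast
      {
        fix y assume "y \<in> ?I"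
        then obtain q d where "y = q + a * d" "q \<in> P" "d \<in> A" by blast
        then have "x + y = (p + q) + a * (c + d)" "p + q \<in> P" "c + d \<in> A"
          using x clo subring_closed by (auto simp: algebra_simps)
        then show "x + y \<in> ?I" by blast
      next
        fix b assume "b \<in> A"
        then have "b * x = b * p + a * (b * c)" "b * p \<in> P" "b * c \<in> A"
          using x clo subring_closed by (auto simp: algebra_simps)
        then show "b * x \<in> ?I" by blast
      }
    qed
    moreover have "?I \<noteq> {0}"
    proof
      assume "?I = {0}"
      with aI have "a = 0" by (metis singletonD)
      with a clo(1) show False by simp
    qed
    moreover have "gv_free A ?I" using no by (auto simp: gv_free_def) blast
    ultimately obtain M where M: "M \<in> ss_QMax A (ss_finite_type A (ss_v A))" "?I \<subseteq> M"
      using gv_free_imp_subset_QMax by blast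
    then have "M = P" using P sub by (auto simp: ss_QMax_def)
    then show False using M aI a by blast
  qed
  show "ss_prime A P"
    unfolding ss_prime_def
  proof (intro conjI ballI impI id)
    fix a b assume ab: "a \<in> A" "b \<in> A" "a * b \<in> P"
    show "a \<in> P \<or> b \<in> P"
    proof (rule ccontr)
      assume "\<not> ?thesis"
      then have ab': "a \<notin> P" "b \<notin> P" by auto
      obtain F where F: "gv_set A F" "\<forall>f\<in>F. \<exists>p\<in>P. \<exists>c\<in>A. f = p + a * c"
        using ex[OF ab(1) ab'(1)] by auto
      obtain G where G: "gv_set A G" "\<forall>f\<in>G. \<exists>p\<in>P. \<exists>c\<in>A. f = p + b * c"
        using ex[OF ab(2) ab'(2)] by auto
      have "f * g \<in> P" if "f \<in> F" "g \<in> G" for f g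
      proof -
        obtain p c q d where "p \<in> P" "c \<in> A" "f = p + a * c" "q \<in> P" "d \<in> A" "g = q + b * d"
          using F(2) G(2) \<open>f \<in> F\<close> \<open>g \<in> G\<close> by blast
        moreover from this have "f * g = (q + b * d) * p + (a * c) * q + (c * d) * (a * b)"
          by (simp add: algebra_simps)
        ultimately show ?thesis using ab clo subring_closed by auto
      qed
      then have "(\<lambda>(f, g). f * g) ` (F \<times> G) \<subseteq> P" by auto
      with free gv_set_mult[OF F(1) G(1)] show False by (auto simp: gv_free_def)
    qed
  qed
qed

section \<open>Membership in the w-closure\<close>

lemma span_loc_denominator:
  assumes P: "ss_prime A P" and E: "ss_submod A E" and x: "x \<in> ss_span (ss_loc A P) E"
  shows "\<exists>s\<in>A. s \<notin> P \<and> s * x \<in> E"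
  using x
proof induction
  case zero
  have one: "1 \<notin> P" using P ideal_eq_self_iff by (auto simp: ss_prime_def)
  then show ?case using one E subring_closed(2) by (auto simp: ss_submod_def intro!: bexI[of _ 1])
next
  case (base e)
  have one: "1 \<notin> P" using P ideal_eq_self_iff by (auto simp: ss_prime_def)
  then show ?case using base subring_closed(2) by (metis mult_1)
next
  case (smult r y)
  then obtain s where s: "s \<in> A" "s \<notin> P" "s * y \<in> E" by auto
  obtain a t where t: "r = a / t" "a \<in> A" "t \<in> A" "t \<notin> P"
    using smult by (auto simp: ss_loc_def)
  have "t \<noteq> 0" using t P by (auto simp: ss_prime_def ss_ideal_def ss_submod_def)
  then have "(t * s) * (r * y) = a * (s * y)" using t by simp
  moreover have "t * s \<in> A" "t * s \<notin> P"
    using s t P subring_closed(5) unfolding ss_prime_def by blast+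
  ultimately show ?case using s t E by (metis ss_submod_def)
next
  case (add y z)
  then obtain s t where s: "s \<in> A" "s \<notin> P" "s * y \<in> E" "t \<in> A" "t \<notin> P" "t * z \<in> E" by auto
  then have "(t * s) * (y + z) = t * (s * y) + s * (t * z)" by (simp add: algebra_simps)
  moreover have "t * s \<in> A" "t * s \<notin> P"
    using s P subring_closed(5) unfolding ss_prime_def by blast+
  ultimately show ?case using s E by (metis ss_submod_def)
qed

text \<open>No maximal t-ideal \<open>P\<close> contains \<open>J\<close>, so some element of
  \<open>J\<close> is invertible in the localization at \<open>P\<close>, and \<open>x\<close> is
  recovered from its product with it.\<close>

lemma w_memI:
  assumes "gv_set A J" "\<And>j. j \<in> J \<Longrightarrow> j * x \<in> E"
  shows "x \<in> ss_w A E"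
proof -
  have "x \<in> ss_span (ss_loc A P) E" if P: "P \<in> ss_QMax A (ss_finite_type A (ss_v A))" for P
  proof -
    have "\<not> J \<subseteq> P" using QMax_t_prime(2)[OF P] assms(1) by (auto simp: gv_free_def)
    then obtain j where j: "j \<in> J" "j \<notin> P" by auto
    have "j \<in> A" using assms j by (auto simp: gv_set_def)
    moreover have "j \<noteq> 0"
      using j QMax_t_prime(1)[OF P] by (auto simp: ss_prime_def ss_ideal_def ss_submod_def)
    moreover have "1 / j \<in> ss_loc A P"
      using \<open>j \<in> A\<close> j subring_closed by (auto simp: ss_loc_def)
    ultimately show ?thesis
      using ss_span.smult[of "1 / j" "ss_loc A P" "j * x" E] ss_span.base[of "j * x" E]
        assms(2)[OF j(1)] by simp
  qed
  then show ?thesis by (auto simp: ss_w_def ss_tilde_def)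
qed

text \<open>The ideal of all \<open>a\<close> in \<open>A\<close> with \<open>a * x\<close> in
  \<open>E\<close> lies in no maximal t-ideal, because at each of them \<open>x\<close> has a
  denominator outside. Being nonzero, it must contain a GV set.\<close>

lemma w_memD:
  assumes frac: "\<forall>x. \<exists>a\<in>A. \<exists>b\<in>A. b \<noteq> 0 \<and> x = a / b"
    and E: "ss_nzmod A E" and x: "x \<in> ss_w A E"
  shows "\<exists>J. gv_set A J \<and> (\<forall>j\<in>J. j * x \<in> E)"
proof -
  let ?I = "{a \<in> A. a * x \<in> E}"
  have sE: "ss_submod A E" using E by (simp add: ss_nzmod_def)
  have "ss_ideal A ?I"
    using sE subring_closed
    by (auto simp: ss_ideal_def ss_submod_def distrib_right mult.assoc)
  moreover have "?I \<noteq> {0}"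
  proof -
    obtain e where e: "e \<in> E" "e \<noteq> 0" using E by (auto simp: ss_nzmod_def ss_submod_def)
    \<comment> \<open>Writing \<open>x / e\<close> as a fraction yields a nonzero \<open>b\<close>
      with \<open>b * x = a * e\<close> in \<open>E\<close>.\<close>
    obtain a b where ab: "a \<in> A" "b \<in> A" "b \<noteq> 0" "x / e = a / b" using frac by metis
    then have "b * x = a * e" using e by (simp add: field_simps)
    then have "b \<in> ?I" using ab e sE by (auto simp: ss_submod_def)
    with ab show ?thesis by auto
  qed
  moreover have "\<not> ?I \<subseteq> P" if P: "P \<in> ss_QMax A (ss_finite_type A (ss_v A))" for P
  proof -
    have "x \<in> ss_span (ss_loc A P) E" using x P by (auto simp: ss_w_def ss_tilde_def)
    from span_loc_denominator[OF QMax_t_prime(1)[OF P] sE this] show ?thesis by auto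
  qed
  ultimately have "\<not> gv_free A ?I" using gv_free_imp_subset_QMax by blast
  then show ?thesis by (auto simp: gv_free_def)
qed

end

section \<open>The closure condition in the definition of \<open>Delta1\<close>\<close>

lemma ss_finite_type_strict_iff:
  assumes "ss_subring D" "ss_ideal D P"
  shows ss_finite_type_v_strict_iff: "ss_finite_type D (ss_v D) P \<subset> ss_v D D \<longleftrightarrow> gv_free D P"
    and ss_finite_type_t_strict_iff: "ss_finite_type D (ss_t D) P \<subset> ss_t D D \<longleftrightarrow> gv_free D P"
proof -
  have P: "ss_submod D P" "P \<subseteq> D" using assms by (auto simp: ss_ideal_def)
  show v: "ss_finite_type D (ss_v D) P \<subset> ss_v D D \<longleftrightarrow> gv_free D P"
  proof (cases "gv_free D P")
    case True
    then have "1 \<notin> ss_finite_type D (ss_v D) P"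
      using one_in_finite_type_v_iff[OF assms(1) P] by simp
    then show ?thesis
      using True finite_type_v_subset[OF assms(1) P(2)] subring_closed(2)[OF assms(1)]
      by (auto simp: ss_v_self[OF assms(1)])
  next
    case False
    then obtain J where J: "J \<subseteq> P" "gv_set D J" by (auto simp: gv_free_def)
    have "ss_nzfg D (ss_span D J)"
      using J by (intro nzfg_span[OF assms(1)]) (auto simp: gv_set_def)
    moreover have "ss_span D J \<subseteq> P" using J P by (intro ss_span_least)
    moreover have "ss_v D (ss_span D J) = D"
      using gv_setD[OF assms(1) J(2)] by (simp add: ss_v_span[OF assms(1)])
    ultimately have "D \<subseteq> ss_finite_type D (ss_v D) P"
      unfolding ss_finite_type_def by blast
    then show ?thesis using False by (auto simp: ss_v_self[OF assms(1)])
  qed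
  \<comment> \<open>\<open>D\<close> is generated by \<open>1\<close>, so it is among the modules
    over which its own t-closure is formed.\<close>
  have "ss_t D D = ss_v D D"
  proof
    show "ss_t D D \<subseteq> ss_v D D"
      unfolding ss_t_def using finite_type_v_subset[OF assms(1), of D] ss_v_self[OF assms(1)] by simp
    show "ss_v D D \<subseteq> ss_t D D"
      unfolding ss_t_def using nzfg_self[OF assms(1)] by (auto simp: ss_finite_type_iff)
  qed
  with v show "ss_finite_type D (ss_t D) P \<subset> ss_t D D \<longleftrightarrow> gv_free D P"
    by (simp add: ss_finite_type_t)
qed

lemma ss_w_mono: "E \<subseteq> F \<Longrightarrow> ss_w A E \<subseteq> ss_w A F"
  unfolding ss_w_def ss_tilde_def using ss_span_mono[of E F] by blast

lemma ss_w_self: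
  assumes "ss_subring D" "\<forall>x. \<exists>a\<in>D. \<exists>b\<in>D. b \<noteq> 0 \<and> x = a / b"
  shows "ss_w D D = D"
proof
  have nz: "ss_nzmod D D"
    using ss_ideal_self[OF assms(1)] subring_closed(2)[OF assms(1)]
    by (auto simp: ss_nzmod_def ss_ideal_def)
  show "ss_w D D \<subseteq> D"
  proof
    fix x assume "x \<in> ss_w D D"
    then obtain J where J: "gv_set D J" "\<forall>j\<in>J. j * x \<in> D"
      using w_memD[OF assms nz] by blast
    then have "x \<in> ss_colon D J" by (auto simp: ss_colon_def mult.commute)
    with J show "x \<in> D" by (auto simp: gv_set_def)
  qed
  show "D \<subseteq> ss_w D D"
    by (auto simp: ss_w_def ss_tilde_def intro: ss_span.base)
qed

text \<open>The argument for v carries over once membership of \<open>1\<close> in the w-closure of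
  \<open>F\<close> is read as saying that \<open>F\<close> contains a GV set.\<close>

lemma ss_finite_type_w_strict_iff:
  assumes D: "ss_subring D" and frac: "\<forall>x. \<exists>a\<in>D. \<exists>b\<in>D. b \<noteq> 0 \<and> x = a / b"
    and P: "ss_ideal D P"
  shows "ss_finite_type D (ss_w D) P \<subset> ss_w D D \<longleftrightarrow> gv_free D P"
proof -
  have P': "ss_submod D P" "P \<subseteq> D" using P by (auto simp: ss_ideal_def)
  have sub: "ss_finite_type D (ss_w D) P \<subseteq> D"
  proof
    fix x assume "x \<in> ss_finite_type D (ss_w D) P"
    then obtain F where "F \<subseteq> P" "x \<in> ss_w D F" by (auto simp: ss_finite_type_iff)
    then show "x \<in> D" using ss_w_mono[of F D D] P' ss_w_self[OF D frac] by auto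
  qed
  show ?thesis
  proof (cases "gv_free D P")
    case True
    have "1 \<notin> ss_finite_type D (ss_w D) P"
    proof
      assume "1 \<in> ss_finite_type D (ss_w D) P"
      then obtain F where F: "F \<subseteq> P" "ss_nzfg D F" "1 \<in> ss_w D F"
        by (auto simp: ss_finite_type_iff)
      then have "ss_nzmod D F"
        using ss_submod_span by (auto simp: ss_nzmod_def ss_nzfg_def)
      then obtain J where "gv_set D J" "\<forall>j\<in>J. j * 1 \<in> F" using w_memD[OF D frac] F by blast
      with True F show False by (auto simp: gv_free_def subset_iff)
    qed
    then show ?thesis
      using True sub subring_closed(2)[OF D] by (auto simp: ss_w_self[OF D frac])
  next
    case False
    then obtain J where J: "J \<subseteq> P" "gv_set D J" by (auto simp: gv_free_def)
    have "ss_nzfg D (ss_span D J)"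
      using J by (intro nzfg_span[OF D]) (auto simp: gv_set_def)
    moreover have "ss_span D J \<subseteq> P" using J P' by (intro ss_span_least)
    moreover have "D \<subseteq> ss_w D (ss_span D J)"
    proof
      fix d assume "d \<in> D"
      then have "d * j \<in> ss_span D J" if "j \<in> J" for j
        using that by (intro ss_span.smult ss_span.base)
      then show "d \<in> ss_w D (ss_span D J)"
        by (intro w_memI[OF D J(2)]) (simp add: mult.commute)
    qed
    ultimately have "D \<subseteq> ss_finite_type D (ss_w D) P"
      unfolding ss_finite_type_def by blast
    then show ?thesis using False by (auto simp: ss_w_self[OF D frac])
  qed
qed

section \<open>Polynomials with coefficients in a subset of a field\<close>

text \<open>This serves at two levels: over subsets of \<open>K\<close> for \<open>D[X]\<close>, and
  over subsets of \<open>K(X)\<close> for \<open>D[X][Y]\<close>. Polynomials are kept apart from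
  their images under \<open>to_fract\<close> so that degrees, coefficients and divisibility are at
  hand.\<close>

definition polys_over :: "'k::field set \<Rightarrow> 'k poly set" where
  "polys_over E = {p. \<forall>i. coeff p i \<in> E}"

lemma DX_eq: "DX D = to_fract ` polys_over D"
  and ext_X_eq: "ext_X D = to_fract ` polys_over D"
  and ext_Y_eq: "ext_Y Q = to_fract ` polys_over Q"
  by (auto simp: DX_def ext_X_def ext_Y_def polys_over_def to_fract_def)

lemma contr_D_eq: "contr_D D Q = {d \<in> D. to_fract [:d:] \<in> Q}"
  by (simp add: contr_D_def to_fract_def)

lemma emb_Y_eq: "emb_Y x = to_fract [:x:]"
  by (simp add: emb_Y_def to_fract_def)

lemma submod_sum:
  "ss_submod A E \<Longrightarrow> (\<And>i. i \<in> I \<Longrightarrow> f i \<in> E) \<Longrightarrow> (\<Sum>i\<in>I. f i) \<in> E"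
  by (induction I rule: infinite_finite_induct) (auto simp: ss_submod_def)

lemma submod_diff:
  assumes "ss_subring A" "ss_submod A E" "x \<in> E" "y \<in> E"
  shows "x - y \<in> E"
proof -
  have "- 1 * y \<in> E"
    using assms subring_uminus[of A 1] subring_closed(2)[of A] unfolding ss_submod_def by blast
  then have "x + (- 1 * y) \<in> E" using assms unfolding ss_submod_def by blast
  then show ?thesis by simp
qed

lemma polys_over_0: "ss_submod A E \<Longrightarrow> 0 \<in> polys_over E"
  and polys_over_add: "ss_submod A E \<Longrightarrow> p \<in> polys_over E \<Longrightarrow> q \<in> polys_over E \<Longrightarrow> p + q \<in> polys_over E"
  and polys_over_smult: "ss_submod A E \<Longrightarrow> a \<in> A \<Longrightarrow> p \<in> polys_over E \<Longrightarrow> smult a p \<in> polys_over E"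
  and polys_over_monom: "ss_submod A E \<Longrightarrow> e \<in> E \<Longrightarrow> monom e n \<in> polys_over E"
  and polys_over_const: "ss_submod A E \<Longrightarrow> e \<in> E \<Longrightarrow> [:e:] \<in> polys_over E"
  by (auto simp: polys_over_def ss_submod_def coeff_pCons split: nat.split)

lemma polys_over_diff:
  "ss_subring A \<Longrightarrow> ss_submod A E \<Longrightarrow> p \<in> polys_over E \<Longrightarrow> q \<in> polys_over E \<Longrightarrow> p - q \<in> polys_over E"
  by (auto simp: polys_over_def submod_diff)

lemma polys_over_mult:
  "ss_submod A E \<Longrightarrow> p \<in> polys_over A \<Longrightarrow> q \<in> polys_over E \<Longrightarrow> p * q \<in> polys_over E"
  unfolding polys_over_def coeff_mult mem_Collect_eq
  by (intro allI submod_sum) (auto simp: ss_submod_def)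

text \<open>The argument of Gauss's lemma: with \<open>i\<close> and \<open>j\<close> the first
  indices at which the coefficients of \<open>f\<close> and \<open>g\<close> leave \<open>Q\<close>,
  the coefficient of the product at \<open>i + j\<close> is \<open>coeff f i * coeff g j\<close>
  modulo \<open>Q\<close>.\<close>

lemma polys_over_mult_prime:
  assumes A: "ss_subring A" and Q: "ss_prime A Q"
    and fg: "f \<in> polys_over A" "g \<in> polys_over A" "f * g \<in> polys_over Q"
  shows "f \<in> polys_over Q \<or> g \<in> polys_over Q"
proof (rule ccontr)
  assume "\<not> ?thesis"
  then have ex: "\<exists>i. coeff f i \<notin> Q" "\<exists>i. coeff g i \<notin> Q" by (auto simp: polys_over_def)
  define i where "i = (LEAST i. coeff f i \<notin> Q)"
  define j where "j = (LEAST j. coeff g j \<notin> Q)"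
  have i: "coeff f i \<notin> Q" and j: "coeff g j \<notin> Q"
    unfolding i_def j_def using LeastI_ex[OF ex(1)] LeastI_ex[OF ex(2)] by simp_all
  have below: "coeff f k \<in> Q" if "k < i" for k
    using that not_less_Least unfolding i_def by blast
  have below': "coeff g k \<in> Q" if "k < j" for k
    using that not_less_Least unfolding j_def by blast
  have sQ: "ss_submod A Q" using Q by (auto simp: ss_prime_def ss_ideal_def)
  have cA: "coeff f k \<in> A" "coeff g k \<in> A" for k using fg by (auto simp: polys_over_def)
  have "coeff (f * g) (i + j) = (\<Sum>k\<le>i + j. coeff f k * coeff g (i + j - k))"
    by (rule coeff_mult)
  also have "\<dots> = coeff f i * coeff g j + (\<Sum>k\<in>{..i + j} - {i}. coeff f k * coeff g (i + j - k))"
    by (subst sum.remove[of _ i]) auto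
  finally have "coeff f i * coeff g j
    = coeff (f * g) (i + j) - (\<Sum>k\<in>{..i + j} - {i}. coeff f k * coeff g (i + j - k))" by simp
  moreover have "(\<Sum>k\<in>{..i + j} - {i}. coeff f k * coeff g (i + j - k)) \<in> Q"
  proof (rule submod_sum[OF sQ])
    fix k assume k: "k \<in> {..i + j} - {i}"
    show "coeff f k * coeff g (i + j - k) \<in> Q"
    proof (cases "k < i")
      case True
      then have "coeff g (i + j - k) * coeff f k \<in> Q"
        using below cA sQ unfolding ss_submod_def by blast
      then show ?thesis by (simp add: mult.commute)
    next
      case False
      with k have "coeff g (i + j - k) \<in> Q" by (intro below') auto
      then show ?thesis using cA sQ unfolding ss_submod_def by blast
    qed
  qed
  moreover have "coeff (f * g) (i + j) \<in> Q" using fg by (auto simp: polys_over_def)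
  ultimately have "coeff f i * coeff g j \<in> Q" using submod_diff[OF A sQ] by simp
  then show False using Q cA i j by (auto simp: ss_prime_def)
qed

section \<open>Coefficient powers as multipliers into a polynomial ring\<close>

context
  fixes A :: "'k::field set"
  assumes A: "ss_subring A"
begin

lemma submod_self: "ss_submod A A"
  using ss_ideal_self[OF A] by (simp add: ss_ideal_def)

lemma polys_over_power: "p \<in> polys_over A \<Longrightarrow> p ^ n \<in> polys_over A"
  using polys_over_const[OF submod_self subring_closed(2)[OF A]]
  by (induction n) (auto simp: one_pCons intro: polys_over_mult[OF submod_self])

text \<open>Induction on the bound \<open>m\<close> for the support of \<open>u\<close>. With
  \<open>c\<close> the coefficient of \<open>g\<close> at \<open>n\<close>, the top coefficient of
  \<open>g * u\<close> is \<open>c\<close> times that of \<open>u\<close> and lies in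
  \<open>A\<close>; removing the corresponding term from \<open>smult c u\<close> keeps the
  hypotheses and lowers the bound, at the price of one factor \<open>c\<close>.\<close>

lemma lead_coeff_power_smult:
  assumes g: "g \<in> polys_over A" "\<And>i. i > n \<Longrightarrow> coeff g i = 0"
    and u: "g * u \<in> polys_over A" "\<And>i. i \<ge> m \<Longrightarrow> coeff u i = 0"
  shows "smult (coeff g n ^ m) u \<in> polys_over A"
  using u
proof (induction m arbitrary: u)
  case 0
  then have "u = 0" by (intro poly_eqI) auto
  then show ?case using polys_over_0[OF submod_self] by simp
next
  case (Suc m)
  define c where "c = coeff g n"
  have cA: "c \<in> A" using g by (auto simp: c_def polys_over_def)
  \<comment> \<open>Only \<open>k = n\<close> survives: above it \<open>g\<close> vanishes, and
    below it the index of \<open>u\<close> exceeds \<open>m\<close>.\<close>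
  have "coeff (g * u) (n + m) = (\<Sum>k\<in>{n}. coeff g k * coeff u (n + m - k))"
    unfolding coeff_mult
  proof (rule sum.mono_neutral_right)
    show "\<forall>k\<in>{..n + m} - {n}. coeff g k * coeff u (n + m - k) = 0"
    proof
      fix k assume "k \<in> {..n + m} - {n}"
      then have "k > n \<or> n + m - k \<ge> Suc m" by auto
      then show "coeff g k * coeff u (n + m - k) = 0" using g(2) Suc.prems(2) by auto
    qed
  qed auto
  then have "c * coeff u m = coeff (g * u) (n + m)" by (simp add: c_def)
  then have top: "c * coeff u m \<in> A" using Suc.prems(1) unfolding polys_over_def by simp
  define u' where "u' = smult c u - monom (c * coeff u m) m"
  have "g * u' = smult c (g * u) - g * monom (c * coeff u m) m"
    by (simp add: u'_def algebra_simps)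
  also have "\<dots> \<in> polys_over A"
    using polys_over_smult[OF submod_self cA Suc.prems(1)]
      polys_over_mult[OF submod_self g(1) polys_over_monom[OF submod_self top]]
    by (rule polys_over_diff[OF A submod_self])
  finally have "g * u' \<in> polys_over A" .
  moreover have "coeff u' i = 0" if "i \<ge> m" for i
    using that Suc.prems(2)[of i] by (cases "i = m") (auto simp: u'_def)
  ultimately have "smult (c ^ m) u' \<in> polys_over A" using Suc.IH by (simp add: c_def)
  moreover have "monom (c ^ m * (c * coeff u m)) m \<in> polys_over A"
    by (rule polys_over_monom[OF submod_self subring_closed(5)[OF A subring_power[OF A cA] top]])
  ultimately have "smult (c ^ m) u' + monom (c ^ m * (c * coeff u m)) m \<in> polys_over A"
    by (rule polys_over_add[OF submod_self])
  also have "smult (c ^ m) u' + monom (c ^ m * (c * coeff u m)) m = smult (c ^ Suc m) u"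
    by (simp add: u'_def smult_diff_right smult_monom mult_ac)
  finally show ?case by (simp add: c_def)
qed

text \<open>A weak form of the Dedekind--Mertens content formula, proved by stripping off leading terms:
  modulo \<open>A[X]\<close> the polynomial \<open>g'\<close> acts on \<open>u\<close> like the leading term \<open>h\<close>, some power of which
  kills \<open>u\<close>.\<close>

lemma coeff_power_smult_bounded:
  assumes "g \<in> polys_over A" "\<And>i. i \<ge> n \<Longrightarrow> coeff g i = 0" "g * u \<in> polys_over A"
  shows "\<exists>N. smult (coeff g k ^ N) u \<in> polys_over A"
  using assms
proof (induction n arbitrary: g u)
  case 0
  then have "smult (coeff g k ^ 1) u \<in> polys_over A" using polys_over_0[OF submod_self] by simp
  then show ?case by blast
next
  case (Suc n)
  note IH = Suc.IH
  define c where "c = coeff g n"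
  define h where "h = monom (- c) n"
  define g' where "g' = g + h"
  obtain M where M: "smult (c ^ M) u \<in> polys_over A"
    using lead_coeff_power_smult[of g n u "Suc (degree u)"] Suc.prems
    by (metis c_def coeff_eq_0 Suc_le_eq)
  have cA: "c \<in> A" using Suc.prems by (auto simp: c_def polys_over_def)
  have hA: "h \<in> polys_over A"
    unfolding h_def using subring_uminus[OF A cA] by (rule polys_over_monom[OF submod_self])
  have g'A: "g' \<in> polys_over A"
    unfolding g'_def using Suc.prems(1) hA by (rule polys_over_add[OF submod_self])
  have g'0: "coeff g' i = 0" if "i \<ge> n" for i
    using that Suc.prems(2)[of i] by (cases "i = n") (auto simp: g'_def h_def c_def)
  have cong: "g' ^ j * u - h ^ j * u \<in> polys_over A" for j
  proof (induction j)
    case 0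
    then show ?case using polys_over_0[OF submod_self] by simp
  next
    case (Suc j)
    \<comment> \<open>The error term is a multiple of \<open>g * u\<close> because
      \<open>g' - h = g\<close>.\<close>
    have "g' ^ Suc j * u - h ^ Suc j * u = g' * (g' ^ j * u - h ^ j * u) + h ^ j * (g * u)"
      by (simp add: g'_def algebra_simps)
    also have "\<dots> \<in> polys_over A"
      using polys_over_mult[OF submod_self g'A Suc]
        polys_over_mult[OF submod_self polys_over_power[OF hA] \<open>g * u \<in> polys_over A\<close>]
      by (rule polys_over_add[OF submod_self])
    finally show ?case .
  qed
  have "h ^ M * u = monom ((- 1) ^ M) (n * M) * smult (c ^ M) u"
    by (simp add: h_def monom_power power_minus[of c] smult_monom flip: mult_smult_left)
  also have "\<dots> \<in> polys_over A"
    using M subring_power[OF A subring_uminus[OF A subring_closed(2)[OF A]]]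
    by (intro polys_over_mult[OF submod_self] polys_over_monom[OF submod_self])
  finally have "(g' ^ M * u - h ^ M * u) + h ^ M * u \<in> polys_over A"
    using cong by (intro polys_over_add[OF submod_self])
  then have g'M: "g' ^ M * u \<in> polys_over A" by simp
  \<comment> \<open>Only a power of \<open>g'\<close> is known to carry \<open>u\<close> into
    \<open>A[X]\<close>, so the outer induction hypothesis is applied once per factor and the
    exponents add up.\<close>
  have strip: "\<exists>N. smult (coeff g' k ^ N) v \<in> polys_over A" if "g' ^ j * v \<in> polys_over A" for j v
    using that
  proof (induction j arbitrary: v)
    case 0
    then have "smult (coeff g' k ^ 0) v \<in> polys_over A" by simp
    then show ?case by blast
  next
    case (Suc j)
    then have "g' * (g' ^ j * v) \<in> polys_over A" by (simp add: mult.assoc)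
    then obtain N where "smult (coeff g' k ^ N) (g' ^ j * v) \<in> polys_over A"
      using IH[OF g'A g'0] by blast
    then have "g' ^ j * smult (coeff g' k ^ N) v \<in> polys_over A" by simp
    then obtain N' where "smult (coeff g' k ^ N') (smult (coeff g' k ^ N) v) \<in> polys_over A"
      using Suc.IH by blast
    then have "smult (coeff g' k ^ (N' + N)) v \<in> polys_over A" by (simp add: power_add)
    then show ?case by blast
  qed
  show ?case
  proof (cases "k = n")
    case True
    with M show ?thesis by (auto simp: c_def)
  next
    case False
    then have "coeff g' k = coeff g k" by (auto simp: g'_def h_def)
    with strip[OF g'M] show ?thesis by simp
  qed
qed

lemma coeff_power_smult:
  assumes "g \<in> polys_over A" "g * u \<in> polys_over A"
  shows "\<exists>N. smult (coeff g k ^ N) u \<in> polys_over A"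
  using assms by (intro coeff_power_smult_bounded[of g "Suc (degree g)"]) (auto simp: coeff_eq_0)

text \<open>Induction on the sum of the exponents. Multiplying \<open>z\<close> by \<open>f\<close>
  lowers the exponent required at \<open>f\<close> by one, so every \<open>f * z\<close> lies in
  \<open>A\<close>; then \<open>z\<close> lies in \<open>(A : F)\<close> and hence in
  \<open>A\<close>.\<close>

lemma colon_powers:
  assumes F: "finite F" "F \<subseteq> A" "ss_colon A F \<subseteq> A"
    and z: "\<And>f. f \<in> F \<Longrightarrow> \<exists>N. f ^ N * z \<in> A"
  shows "z \<in> A"
proof -
  have *: "z \<in> A" if "\<And>f. f \<in> F \<Longrightarrow> f ^ N f * z \<in> A" for N :: "'k \<Rightarrow> nat" and z
    using that
  proof (induction "\<Sum>f\<in>F. N f" arbitrary: N z rule: less_induct)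
    case less
    show ?case
    proof (cases "\<exists>f\<in>F. N f = 0")
      case True
      then show ?thesis using less.prems by force
    next
      case False
      have "f * z \<in> A" if f: "f \<in> F" for f
      proof (rule less.hyps)
        show "(\<Sum>f'\<in>F. (N(f := N f - 1)) f') < (\<Sum>f\<in>F. N f)"
          using F(1) f False by (intro sum_strict_mono_ex1) auto
        fix f' assume f': "f' \<in> F"
        show "f' ^ (N(f := N f - 1)) f' * (f * z) \<in> A"
        proof (cases "f' = f")
          case True
          have "f ^ N f = f ^ (N f - 1) * f" using False f by (metis power_minus_mult neq0_conv)
          with True less.prems[OF f] show ?thesis by (simp add: mult.assoc)
        next
          case False
          then show ?thesis
            using subring_closed(5)[OF A, of f "f' ^ N f' * z"] less.prems[OF f'] f F
            by (auto simp: mult_ac)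
        qed
      qed
      then have "z \<in> ss_colon A F" by (auto simp: ss_colon_def mult.commute)
      with F show ?thesis by blast
    qed
  qed
  from z obtain N where "\<And>f. f \<in> F \<Longrightarrow> f ^ N f * z \<in> A" by metis
  then show ?thesis by (rule *)
qed

end

section \<open>Common denominators\<close>

lemma common_denominator:
  assumes D: "ss_subring D" and frac: "\<forall>x. \<exists>a\<in>D. \<exists>b\<in>D. b \<noteq> 0 \<and> x = a / b"
    and "finite S"
  shows "\<exists>d\<in>D. d \<noteq> 0 \<and> (\<forall>x\<in>S. d * x \<in> D)"
  using \<open>finite S\<close>
proof induction
  case empty
  then show ?case using subring_closed(2)[OF D] by (intro bexI[of _ 1]) auto
next
  case (insert x S)
  then obtain d where d: "d \<in> D" "d \<noteq> 0" "\<forall>x\<in>S. d * x \<in> D" by blast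
  obtain a b where ab: "a \<in> D" "b \<in> D" "b \<noteq> 0" "x = a / b" using frac by metis
  have "(d * b) * y \<in> D" if "y \<in> insert x S" for y
  proof (cases "y = x")
    case True
    then have eq: "(d * b) * y = d * a" using ab by simp
    show ?thesis unfolding eq by (rule subring_closed(5)[OF D d(1) ab(1)])
  next
    case False
    then have "b * (d * y) \<in> D" using that d(3) by (intro subring_closed(5)[OF D ab(2)]) auto
    then show ?thesis by (simp add: mult_ac)
  qed
  moreover have "d * b \<in> D" "d * b \<noteq> 0" using d ab subring_closed(5)[OF D] by auto
  ultimately show ?case by blast
qed

text \<open>Indices beyond the degree contribute only the value \<open>0\<close>, so the whole range
  can serve as the set of coefficients without a degree bound.\<close>

lemma finite_range_coeff: "finite (range (coeff p))"
proof -
  have "coeff p i \<in> coeff p ` {..degree p} \<union> {0}" for i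
    using coeff_eq_0[of p i] by (cases "i \<le> degree p") auto
  then have "range (coeff p) \<subseteq> coeff p ` {..degree p} \<union> {0}" by blast
  then show ?thesis by (rule finite_subset) auto
qed

lemma common_denominator_polys:
  assumes D: "ss_subring D" and frac: "\<forall>x. \<exists>a\<in>D. \<exists>b\<in>D. b \<noteq> 0 \<and> x = a / b"
    and "finite S"
  shows "\<exists>d\<in>D. d \<noteq> 0 \<and> (\<forall>p\<in>S. smult d p \<in> polys_over D)"
proof -
  have "finite (\<Union>p\<in>S. range (coeff p))" using \<open>finite S\<close> finite_range_coeff by blast
  from common_denominator[OF D frac this] show ?thesis by (auto simp: polys_over_def)
qed

section \<open>GV sets of a polynomial ring\<close>

lemma to_fract_mem_DX: "to_fract p \<in> DX D \<longleftrightarrow> p \<in> polys_over D"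
  by (auto simp: DX_eq)

lemma ss_subring_DX:
  assumes D: "ss_subring D"
  shows "ss_subring (DX D)"
proof -
  note sD = submod_self[OF D]
  have "to_fract 0 \<in> DX D" unfolding to_fract_mem_DX by (rule polys_over_0[OF sD])
  moreover have "to_fract 1 \<in> DX D"
    unfolding to_fract_mem_DX one_pCons by (rule polys_over_const[OF sD subring_closed(2)[OF D]])
  moreover have "x + y \<in> DX D \<and> x - y \<in> DX D \<and> x * y \<in> DX D" if "x \<in> DX D" "y \<in> DX D" for x y
  proof -
    obtain p q where "x = to_fract p" "y = to_fract q" "p \<in> polys_over D" "q \<in> polys_over D"
      using \<open>x \<in> DX D\<close> \<open>y \<in> DX D\<close> by (auto simp: DX_eq)
    then show ?thesis
      using polys_over_add[OF sD] polys_over_diff[OF D sD] polys_over_mult[OF sD]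
      by (simp add: to_fract_mem_DX flip: to_fract_add to_fract_diff to_fract_mult)
  qed
  ultimately show ?thesis by (simp add: ss_subring_def)
qed

lemma DX_fractions:
  assumes D: "ss_subring D" and frac: "\<forall>x. \<exists>a\<in>D. \<exists>b\<in>D. b \<noteq> 0 \<and> x = a / b"
  shows "\<forall>x. \<exists>a\<in>DX D. \<exists>b\<in>DX D. b \<noteq> 0 \<and> x = a / b"
proof
  fix x :: "'a poly fract"
  obtain p q where pq: "x = Fract p q" "q \<noteq> 0" by (cases x)
  obtain d where d: "d \<in> D" "d \<noteq> 0" "smult d p \<in> polys_over D" "smult d q \<in> polys_over D"
    using common_denominator_polys[OF D frac, of "{p, q}"] by auto
  have "x = to_fract (smult d p) / to_fract (smult d q)"
    using pq d by (simp add: to_fract_def eq_fract)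
  with d pq show "\<exists>a\<in>DX D. \<exists>b\<in>DX D. b \<noteq> 0 \<and> x = a / b"
    by (intro bexI[of _ "to_fract (smult d p)"] bexI[of _ "to_fract (smult d q)"])
       (auto simp: to_fract_mem_DX)
qed

section \<open>Contraction of primes to \<open>D\<close> and the set \<open>Delta_gv\<close>\<close>

lemma ss_ideal_contr_D:
  assumes D: "ss_subring D" and Q: "ss_ideal (DX D) Q"
  shows "ss_ideal D (contr_D D Q)"
proof -
  have sQ: "ss_submod (DX D) Q" using Q by (simp add: ss_ideal_def)
  have "to_fract [:x + y:] \<in> Q" if "to_fract [:x:] \<in> Q" "to_fract [:y:] \<in> Q" for x y
  proof -
    have "to_fract [:x:] + to_fract [:y:] \<in> Q" using that sQ unfolding ss_submod_def by blast
    then show ?thesis by (simp flip: to_fract_add)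
  qed
  moreover have "to_fract [:a * x:] \<in> Q" if "a \<in> D" "to_fract [:x:] \<in> Q" for a x
  proof -
    have "to_fract [:a:] \<in> DX D"
      using polys_over_const[OF submod_self[OF D] \<open>a \<in> D\<close>] by (simp add: to_fract_mem_DX)
    then have "to_fract [:a:] * to_fract [:x:] \<in> Q"
      using that sQ unfolding ss_submod_def by blast
    then show ?thesis by (simp add: mult.commute flip: to_fract_mult)
  qed
  moreover have "0 \<in> Q" using sQ by (simp add: ss_submod_def)
  ultimately show ?thesis
    using subring_closed[OF D] by (simp add: ss_ideal_def ss_submod_def contr_D_eq)
qed

text \<open>The shape that \<open>Delta1\<close> takes for the v-, t- and w-operations once the
  closure condition is expressed through GV sets.\<close>

definition Delta_gv :: "'a::field set \<Rightarrow> 'a poly fract set set" where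
  "Delta_gv D = {Q. ss_prime (DX D) Q \<and>
     (contr_D D Q = {0} \<or> Q = ext_X (contr_D D Q) \<and> gv_free D (contr_D D Q))}"

lemma Delta1_eq_Delta_gv:
  assumes D: "ss_subring D" and frac: "\<forall>x. \<exists>a\<in>D. \<exists>b\<in>D. b \<noteq> 0 \<and> x = a / b"
  shows "Delta1 D (ss_v D) = Delta_gv D" "Delta1 D (ss_t D) = Delta_gv D"
    "Delta1 D (ss_w D) = Delta_gv D"
proof -
  have id: "ss_ideal D (contr_D D Q)" if "ss_prime (DX D) Q" for Q
    using that ss_ideal_contr_D[OF D] by (simp add: ss_prime_def)
  show "Delta1 D (ss_v D) = Delta_gv D" "Delta1 D (ss_t D) = Delta_gv D"
    "Delta1 D (ss_w D) = Delta_gv D"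
    unfolding Delta1_def Delta_gv_def
    using ss_finite_type_v_strict_iff[OF D id] ss_finite_type_t_strict_iff[OF D id]
      ss_finite_type_w_strict_iff[OF D frac id]
    by blast+
qed

lemma Delta_gv_prime: "Q \<in> Delta_gv D \<Longrightarrow> ss_prime (DX D) Q"
  by (simp add: Delta_gv_def)

text \<open>Membership of the zero prime ensures that finite sets contained in no member have a
  nonzero element, and that denominators in \<open>S1\<close> are nonzero.\<close>

lemma zero_in_Delta_gv:
  assumes D: "ss_subring D"
  shows "{0} \<in> Delta_gv D"
proof -
  note A = subring_closed[OF ss_subring_DX[OF D]]
  have "{0} \<noteq> DX D" using A(2) by (metis singletonD zero_neq_one)
  then have "ss_prime (DX D) {0}"
    using A(1,2) by (auto simp: ss_prime_def ss_ideal_def ss_submod_def)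
  moreover have "contr_D D {0} = {0}" using subring_closed(1)[OF D] by (auto simp: contr_D_eq)
  ultimately show ?thesis by (simp add: Delta_gv_def)
qed

text \<open>If \<open>J\<close> were inside \<open>Q\<close>, some multiplier of \<open>J\<close>
  into \<open>D[X]\<close> would lie outside \<open>D[X]\<close>: a fraction \<open>d / f\<close>,
  with \<open>f\<close> generating the extension of \<open>Q\<close> to \<open>K[X]\<close>, when
  \<open>Q\<close> contracts to zero; otherwise a constant \<open>z\<close> outside \<open>D\<close>
  that carries all coefficients occurring in \<open>J\<close> into \<open>D\<close>.\<close>

lemma gv_set_DX_not_subset:
  assumes D: "ss_subring D" and frac: "\<forall>x. \<exists>a\<in>D. \<exists>b\<in>D. b \<noteq> 0 \<and> x = a / b"
    and J: "gv_set (DX D) J" and Q: "Q \<in> Delta_gv D"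
  shows "\<not> J \<subseteq> Q"
proof
  assume JQ: "J \<subseteq> Q"
  define J' where "J' = {p. to_fract p \<in> J}"
  have JJ': "J = to_fract ` J'" using J by (auto simp: J'_def gv_set_def DX_eq)
  have finJ': "finite J'"
    using J finite_imageD[of to_fract J'] JJ' by (auto simp: gv_set_def inj_on_def)
  have J'D: "J' \<subseteq> polys_over D" using J by (auto simp: J'_def gv_set_def DX_eq)
  have pQ: "ss_prime (DX D) Q" using Q by (rule Delta_gv_prime)
  then have sQ: "ss_submod (DX D) Q" by (simp add: ss_prime_def ss_ideal_def)
  have mQ: "to_fract (p * q) \<in> Q" if "p \<in> polys_over D" "to_fract q \<in> Q" for p q
    using that sQ by (auto simp: ss_submod_def to_fract_mem_DX)
  have smQ: "to_fract (smult a q) \<in> Q" if "a \<in> D" "to_fract q \<in> Q" for a q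
    using mQ[OF polys_over_const[OF submod_self[OF D] that(1)] that(2)] by simp
  show False
  proof (cases "contr_D D Q = {0}")
    case True
    \<comment> \<open>This is the extension of \<open>Q\<close> to \<open>K[X]\<close>, written with
      a single denominator from \<open>D\<close>.\<close>
    define I where "I = {p. \<exists>d\<in>D. d \<noteq> 0 \<and> to_fract (smult d p) \<in> Q}"
    have J'I: "J' \<subseteq> I"
      using JQ subring_closed(2)[OF D] by (auto simp: I_def J'_def intro!: bexI[of _ 1])
    have "\<not> J' \<subseteq> {0}" using J JJ' by (auto simp: gv_set_def)
    then obtain p\<^sub>0 where p\<^sub>0: "p\<^sub>0 \<in> J'" "p\<^sub>0 \<noteq> 0" by auto
    obtain f where f: "f \<in> I" "f \<noteq> 0" and min: "\<And>p. p \<in> I \<Longrightarrow> p \<noteq> 0 \<Longrightarrow> degree f \<le> degree p"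
      using ex_has_least_nat[of "\<lambda>p. p \<in> I \<and> p \<noteq> 0" p\<^sub>0 degree] p\<^sub>0 J'I by blast
    obtain d\<^sub>f where d\<^sub>f: "d\<^sub>f \<in> D" "d\<^sub>f \<noteq> 0" "to_fract (smult d\<^sub>f f) \<in> Q"
      using f by (auto simp: I_def)
    have dvd: "f dvd p" if "p \<in> I" for p
    proof -
      obtain d where d: "d \<in> D" "d \<noteq> 0" "to_fract (smult d p) \<in> Q"
        using \<open>p \<in> I\<close> by (auto simp: I_def)
      obtain e where e: "e \<in> D" "e \<noteq> 0" "smult e (p div f) \<in> polys_over D"
        using common_denominator_polys[OF D frac, of "{p div f}"] by auto
      \<comment> \<open>The denominators for dividend, divisor and quotient are cleared at once, so
        the remainder stays in \<open>I\<close> and vanishes because \<open>f\<close> has least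
        degree.\<close>
      have "smult (d\<^sub>f * e * d) (p mod f)
          = smult (d\<^sub>f * e) (smult d p) - smult d (smult e (p div f) * smult d\<^sub>f f)"
        by (simp add: minus_mult_div_eq_mod[symmetric] smult_diff_right mult_ac)
      moreover have "d\<^sub>f * e \<in> D" using d\<^sub>f e subring_closed(5)[OF D] by blast
      ultimately have "to_fract (smult (d\<^sub>f * e * d) (p mod f)) \<in> Q"
        using submod_diff[OF ss_subring_DX[OF D] sQ smQ[OF _ d(3)] smQ[OF d(1) mQ[OF e(3) d\<^sub>f(3)]]]
        by simp
      moreover have "d\<^sub>f * e * d \<in> D" "d\<^sub>f * e * d \<noteq> 0"
        using d d\<^sub>f e subring_closed(5)[OF D] by auto
      ultimately have "p mod f \<in> I" unfolding I_def by blast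
      with min[of "p mod f"] degree_mod_less[OF f(2), of p] have "p mod f = 0" by linarith
      then show ?thesis by (rule mod_0_imp_dvd)
    qed
    \<comment> \<open>A constant generator would yield a nonzero element of \<open>D\<close> in
      \<open>Q\<close>.\<close>
    have deg: "degree f \<noteq> 0"
    proof
      assume "degree f = 0"
      then obtain c where c: "f = [:c:]" by (rule degree_eq_zeroE)
      obtain a b where ab: "a \<in> D" "b \<in> D" "b \<noteq> 0" "c = a / b" using frac by metis
      have "smult b (smult d\<^sub>f f) = [:d\<^sub>f * a:]" using ab c by simp
      then have "d\<^sub>f * a \<in> contr_D D Q"
        using smQ[OF ab(2) d\<^sub>f(3)] d\<^sub>f(1) ab(1) subring_closed(5)[OF D] by (simp add: contr_D_eq)
      with True d\<^sub>f f ab c show False by auto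
    qed
    obtain d where d: "d \<in> D" "d \<noteq> 0" "\<And>p. p \<in> J' \<Longrightarrow> smult d (p div f) \<in> polys_over D"
      using common_denominator_polys[OF D frac, of "(\<lambda>p. p div f) ` J'"] finJ' by auto
    \<comment> \<open>The fraction \<open>d / f\<close> carries \<open>J\<close> into
      \<open>D[X]\<close> but is not a polynomial, since the nonconstant \<open>f\<close> divides no
      nonzero constant.\<close>
    have "to_fract [:d:] / to_fract f * to_fract p \<in> DX D" if "p \<in> J'" for p
    proof -
      have "f * (p div f) = p" using dvd J'I that by auto
      then have "to_fract p = to_fract f * to_fract (p div f)" by (metis to_fract_mult)
      then have "to_fract [:d:] / to_fract f * to_fract p = to_fract [:d:] * to_fract (p div f)"
        using f(2) by simp
      also have "\<dots> = to_fract (smult d (p div f))" by (simp flip: to_fract_mult)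
      finally have "to_fract [:d:] / to_fract f * to_fract p = to_fract (smult d (p div f))" .
      then show ?thesis using d(3)[OF that] by (simp add: to_fract_mem_DX)
    qed
    then have "to_fract [:d:] / to_fract f \<in> ss_colon (DX D) J" by (auto simp: ss_colon_def JJ')
    then obtain h where "to_fract [:d:] / to_fract f = to_fract h"
      using J by (auto simp: gv_set_def DX_eq)
    then have "to_fract [:d:] = to_fract (h * f)" using f by (simp add: field_simps)
    then have *: "[:d:] = h * f" by (simp only: to_fract_eq_iff)
    then have "h \<noteq> 0" using d by auto
    then have "degree [:d:] = degree h + degree f" using * f by (simp add: degree_mult_eq)
    with deg show False by simp
  next
    case False
    define P where "P = contr_D D Q"
    have P: "Q = ext_X P" "gv_free D P" using Q False by (auto simp: Delta_gv_def P_def)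
    have J'P: "J' \<subseteq> polys_over P" using JQ P by (auto simp: JJ' ext_X_eq)
    define F where "F = (\<Union>p\<in>J'. range (coeff p))"
    have "F \<subseteq> P" using J'P by (auto simp: F_def polys_over_def)
    with P have "\<not> gv_set D F" by (auto simp: gv_free_def)
    moreover have "finite F" using finJ' finite_range_coeff by (auto simp: F_def)
    moreover have "F \<subseteq> D" using J'D by (auto simp: F_def polys_over_def)
    moreover have "\<not> F \<subseteq> {0}"
    proof
      assume "F \<subseteq> {0}"
      then have "J' \<subseteq> {0}" unfolding F_def by (fastforce simp: poly_eq_iff)
      with J JJ' show False by (auto simp: gv_set_def)
    qed
    ultimately obtain z where z: "z \<in> ss_colon D F" "z \<notin> D" by (auto simp: gv_set_def)
    have "to_fract [:z:] * to_fract p \<in> DX D" if "p \<in> J'" for p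
    proof -
      have "smult z p \<in> polys_over D" using z that by (auto simp: polys_over_def F_def ss_colon_def)
      then show ?thesis by (simp add: to_fract_mem_DX flip: to_fract_mult)
    qed
    then have "to_fract [:z:] \<in> ss_colon (DX D) J" by (auto simp: ss_colon_def JJ')
    then have "[:z:] \<in> polys_over D" using J by (auto simp: gv_set_def simp flip: to_fract_mem_DX)
    then have "coeff [:z:] 0 \<in> D" unfolding polys_over_def by blast
    with z show False by simp
  qed
qed

section \<open>Construction of primes in \<open>Delta_gv\<close>\<close>

lemma contr_D_ext_X:
  assumes "ss_ideal D P"
  shows "contr_D D (ext_X P) = P"
proof -
  have "[:d:] \<in> polys_over P \<longleftrightarrow> d \<in> P" for d
    using polys_over_const[of D P d] assms
    by (auto simp: ss_ideal_def polys_over_def dest: spec[of _ 0])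
  then show ?thesis using assms by (auto simp: contr_D_eq ext_X_eq ss_ideal_def)
qed

lemma ss_prime_ext_X:
  assumes D: "ss_subring D" and P: "ss_prime D P"
  shows "ss_prime (DX D) (ext_X P)"
proof -
  have sP: "ss_submod D P" "P \<subseteq> D" "P \<noteq> D" using P by (auto simp: ss_prime_def ss_ideal_def)
  have mem: "to_fract p \<in> ext_X P \<longleftrightarrow> p \<in> polys_over P" for p by (auto simp: ext_X_eq)
  have "polys_over P \<subseteq> polys_over D" using sP by (auto simp: polys_over_def)
  then have "ext_X P \<subseteq> DX D" by (auto simp: ext_X_eq DX_eq)
  moreover have "0 \<in> ext_X P" using mem[of 0] polys_over_0[OF sP(1)] by simp
  moreover have "x + y \<in> ext_X P" if "x \<in> ext_X P" "y \<in> ext_X P" for x y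
    using that polys_over_add[OF sP(1)] by (auto simp: ext_X_eq simp flip: to_fract_add)
  moreover have "a * x \<in> ext_X P" if "a \<in> DX D" "x \<in> ext_X P" for a x
    using that polys_over_mult[OF sP(1)] by (auto simp: ext_X_eq DX_eq simp flip: to_fract_mult)
  moreover have "ext_X P \<noteq> DX D"
  proof
    assume "ext_X P = DX D"
    then have "1 \<in> ext_X P" using subring_closed(2)[OF ss_subring_DX[OF D]] by simp
    then have "[:1:] \<in> polys_over P" using mem[of 1] by (simp flip: one_pCons)
    then have "coeff [:1:] 0 \<in> P" unfolding polys_over_def by blast
    then show False using P ideal_eq_self_iff[OF D, of P] by (simp add: ss_prime_def)
  qed
  moreover have "a \<in> ext_X P \<or> b \<in> ext_X P" if ab: "a \<in> DX D" "b \<in> DX D" "a * b \<in> ext_X P" for a b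
  proof -
    obtain f g where fg: "a = to_fract f" "b = to_fract g" "f \<in> polys_over D" "g \<in> polys_over D"
      using ab by (auto simp: DX_eq)
    then have "f * g \<in> polys_over P" using ab(3) mem[of "f * g"] by simp
    then show ?thesis using polys_over_mult_prime[OF D P fg(3,4)] fg(1,2) mem by blast
  qed
  ultimately show ?thesis by (simp add: ss_prime_def ss_ideal_def ss_submod_def)
qed

text \<open>This is the contraction of the prime \<open>p K[X]\<close> to \<open>D[X]\<close>. It
  meets \<open>D\<close> in zero because a nonconstant \<open>p\<close> divides no nonzero
  constant.\<close>

lemma prime_multiples_in_Delta_gv:
  assumes D: "ss_subring D" and p: "prime_elem p" and deg: "degree p \<noteq> 0"
  shows "{to_fract g | g. g \<in> polys_over D \<and> p dvd g} \<in> Delta_gv D" (is "?Q \<in> _")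
proof -
  note sD = submod_self[OF D]
  have mem: "to_fract g \<in> ?Q \<longleftrightarrow> g \<in> polys_over D \<and> p dvd g" for g by auto
  have QD: "?Q \<subseteq> DX D" by (auto simp: DX_eq)
  have Q0: "0 \<in> ?Q" using mem[of 0] polys_over_0[OF sD] by simp
  have Qadd: "x + y \<in> ?Q" if xy: "x \<in> ?Q" "y \<in> ?Q" for x y
  proof -
    obtain g h where "x = to_fract g" "y = to_fract h" using xy by blast
    with xy show ?thesis
      using polys_over_add[OF sD] dvd_add by (simp only: mem flip: to_fract_add) blast
  qed
  have Qmult: "a * x \<in> ?Q" if ax: "a \<in> DX D" "x \<in> ?Q" for a x
  proof -
    obtain g h where "a = to_fract g" "x = to_fract h" using ax by (auto simp: DX_eq)
    with ax show ?thesis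
      using polys_over_mult[OF sD] dvd_mult by (simp only: mem to_fract_mem_DX flip: to_fract_mult) blast
  qed
  have "\<not> p dvd 1" using p by (simp add: prime_elem_def)
  then have "1 \<notin> ?Q" using mem[of 1] by simp
  then have Q1: "?Q \<noteq> DX D" using subring_closed(2)[OF ss_subring_DX[OF D]] by metis
  have Qpr: "a \<in> ?Q \<or> b \<in> ?Q" if ab: "a \<in> DX D" "b \<in> DX D" "a * b \<in> ?Q" for a b
  proof -
    obtain g h where "a = to_fract g" "b = to_fract h" using ab by (auto simp: DX_eq)
    with ab show ?thesis
      using prime_elem_dvd_multD[OF p]
      by (simp only: mem to_fract_mem_DX flip: to_fract_mult) blast
  qed
  have prime: "ss_prime (DX D) ?Q"
    unfolding ss_prime_def ss_ideal_def ss_submod_def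
    by (intro conjI ballI impI QD Q0 Q1; (rule Qadd Qmult Qpr; assumption))
  have "d = 0" if "p dvd [:d:]" for d
  proof (rule ccontr)
    assume "d \<noteq> 0"
    then show False using dvd_imp_degree_le[OF that] deg by simp
  qed
  moreover have "0 \<in> contr_D D ?Q"
    using mem[of 0] polys_over_0[OF sD] subring_closed(1)[OF D] by (simp add: contr_D_eq)
  ultimately have "contr_D D ?Q = {0}" by (auto simp: contr_D_eq)
  with prime show ?thesis by (simp only: Delta_gv_def) blast
qed

text \<open>A nonconstant divisor of least degree is irreducible, and irreducible polynomials over a
  field are prime.\<close>

lemma prime_poly_factor:
  fixes b :: "'k::field poly"
  assumes "degree b \<noteq> 0"
  shows "\<exists>p. prime_elem p \<and> degree p \<noteq> 0 \<and> p dvd b"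
proof -
  obtain p where p: "degree p \<noteq> 0" "p dvd b"
    and min: "\<And>q. degree q \<noteq> 0 \<Longrightarrow> q dvd b \<Longrightarrow> degree p \<le> degree q"
    using ex_has_least_nat[of "\<lambda>p. degree p \<noteq> 0 \<and> p dvd b" b degree, OF conjI[OF assms dvd_refl]]
    by auto
  have "irreducible p"
  proof (rule irreducibleI)
    show p0: "p \<noteq> 0" using p by auto
    show "\<not> p dvd 1" using p p0 by (simp add: is_unit_iff_degree)
    fix x y assume xy: "p = x * y"
    then have nz: "x \<noteq> 0" "y \<noteq> 0" using p0 by auto
    then have "degree p = degree x + degree y" using xy by (simp add: degree_mult_eq)
    moreover have "x dvd b" using xy p(2) dvd_mult_left by blast
    ultimately have "degree x = 0 \<or> degree y = 0" using min[of x] by fastforce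
    with nz show "x dvd 1 \<or> y dvd 1" by (simp add: is_unit_iff_degree)
  qed
  with p field_poly_irreducible_imp_prime show ?thesis by blast
qed

text \<open>A multiplier \<open>u\<close> of \<open>J\<close> is confined in two stages: the primes
  contracting to zero force it into \<open>K[X]\<close>, and the primes \<open>P[X]\<close> make the
  coefficients occurring in \<open>J\<close> a GV set of \<open>D\<close>, which forces the
  coefficients of \<open>u\<close> into \<open>D\<close>.\<close>

lemma gv_set_DX_if_not_subset:
  assumes D: "ss_subring D" and J: "finite J" "J \<subseteq> DX D"
    and not: "\<And>Q. Q \<in> Delta_gv D \<Longrightarrow> \<not> J \<subseteq> Q"
  shows "gv_set (DX D) J"
proof -
  define J' where "J' = {p. to_fract p \<in> J}"
  have JJ': "J = to_fract ` J'" using J by (auto simp: J'_def DX_eq)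
  have finJ': "finite J'"
    using J finite_imageD[of to_fract J'] JJ' by (auto simp: inj_on_def)
  have J'D: "J' \<subseteq> polys_over D" using J by (auto simp: J'_def DX_eq)
  have J0: "\<not> J \<subseteq> {0}" by (rule not[OF zero_in_Delta_gv[OF D]])
  define F where "F = (\<Union>p\<in>J'. range (coeff p))"
  have F: "finite F" "F \<subseteq> D"
    using finJ' finite_range_coeff J'D by (auto simp: F_def polys_over_def)
  have "\<not> F \<subseteq> {0}"
  proof
    assume "F \<subseteq> {0}"
    then have "J' \<subseteq> {0}" unfolding F_def by (fastforce simp: poly_eq_iff)
    with J0 JJ' show False by auto
  qed
  have colF: "ss_colon D F \<subseteq> D"
  proof (rule ccontr)
    \<comment> \<open>Otherwise the span of \<open>F\<close> is free of GV sets and lies in a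
      maximal t-ideal \<open>P\<close>, so that \<open>J\<close> is contained in
      \<open>P[X]\<close>, a member of \<open>Delta_gv\<close>.\<close>
    assume bad: "\<not> ss_colon D F \<subseteq> D"
    have I: "ss_span D F \<subseteq> D" using F submod_self[OF D] by (intro ss_span_least)
    have "gv_free D (ss_span D F)"
      unfolding gv_free_def
    proof (intro allI impI notI)
      fix G assume G: "G \<subseteq> ss_span D F" "gv_set D G"
      have "ss_colon D F \<subseteq> ss_colon D G"
        using ss_colon_antimono[OF G(1), of D] by (simp add: ss_colon_span[OF D])
      with G bad show False by (auto simp: gv_set_def)
    qed
    moreover have "ss_span D F \<noteq> {0}" using \<open>\<not> F \<subseteq> {0}\<close> ss_span_superset by blast
    moreover have "ss_ideal D (ss_span D F)" using I ss_submod_span by (simp add: ss_ideal_def)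
    ultimately obtain P where P: "P \<in> ss_QMax D (ss_finite_type D (ss_v D))" "ss_span D F \<subseteq> P"
      using gv_free_imp_subset_QMax[OF D] by blast
    have prime: "ss_prime D P" "gv_free D P" using QMax_t_prime[OF D P(1)] by auto
    then have "contr_D D (ext_X P) = P" by (intro contr_D_ext_X) (simp add: ss_prime_def)
    with prime ss_prime_ext_X[OF D] have "ext_X P \<in> Delta_gv D" by (simp add: Delta_gv_def)
    moreover have "F \<subseteq> P" using P(2) ss_span_superset by blast
    then have "J' \<subseteq> polys_over P" by (auto simp: F_def polys_over_def)
    then have "J \<subseteq> ext_X P" by (auto simp: JJ' ext_X_eq)
    ultimately show False using not by blast
  qed
  have "u \<in> DX D" if u: "u \<in> ss_colon (DX D) J" for u
  proof -
    obtain a\<^sub>0 b\<^sub>0 where "u = Fract a\<^sub>0 b\<^sub>0" "b\<^sub>0 \<noteq> 0" by (cases u)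
    then have "b\<^sub>0 \<noteq> 0 \<and> (\<exists>a. u = to_fract a / to_fract b\<^sub>0)" by (auto simp: to_fract_def)
    \<comment> \<open>A denominator of least degree replaces coprimality: a nonconstant factor
      shared with the numerator could be cancelled.\<close>
    then obtain b where b: "b \<noteq> 0 \<and> (\<exists>a. u = to_fract a / to_fract b)"
      and min: "\<And>b'. b' \<noteq> 0 \<and> (\<exists>a. u = to_fract a / to_fract b') \<Longrightarrow> degree b \<le> degree b'"
      using ex_has_least_nat[of "\<lambda>b. b \<noteq> 0 \<and> (\<exists>a. u = to_fract a / to_fract b)" b\<^sub>0 degree] by blast
    then obtain a where a: "u = to_fract a / to_fract b" by blast
    have uJ: "\<exists>h\<in>polys_over D. u * to_fract g = to_fract h" if "g \<in> J'" for g
      using u that by (auto simp: ss_colon_def JJ' DX_eq)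
    have "degree b = 0"
    proof (rule ccontr)
      assume "degree b \<noteq> 0"
      then obtain p where p: "prime_elem p" "degree p \<noteq> 0" "p dvd b" using prime_poly_factor by blast
      \<comment> \<open>\<open>J\<close> is not contained in the prime formed by the multiples of
        \<open>p\<close>, so some \<open>g\<close> is not divisible by \<open>p\<close>, and
        \<open>p\<close> must then divide the numerator.\<close>
      obtain g where g: "g \<in> J'" "\<not> p dvd g"
        using not[OF prime_multiples_in_Delta_gv[OF D p(1,2)]] J'D by (auto simp: JJ')
      obtain h where "u * to_fract g = to_fract h" using uJ[OF g(1)] by blast
      then have "to_fract (a * g) = to_fract (b * h)" using a b by (simp add: field_simps)
      then have "a * g = b * h" by (simp only: to_fract_eq_iff)
      then have "p dvd a * g" using p(3) by simp
      then have "p dvd a" using prime_elem_dvd_multD[OF p(1)] g(2) by blast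
      then obtain a' b' where ab': "a = p * a'" "b = p * b'" using p(3) unfolding dvd_def by blast
      with b have nz: "p \<noteq> 0" "b' \<noteq> 0" by auto
      then have "u = to_fract a' / to_fract b'" using a ab' by simp
      then have "degree b \<le> degree b'" using min nz by blast
      with ab' nz p(2) show False by (simp add: degree_mult_eq)
    qed
    then obtain c where c: "b = [:c:]" by (rule degree_eq_zeroE)
    with b have "c \<noteq> 0" by auto
    define v where "v = smult (1 / c) a"
    have "to_fract a = to_fract v * to_fract b"
      using c \<open>c \<noteq> 0\<close> by (simp add: v_def flip: to_fract_mult)
    then have uv: "u = to_fract v" using a b by simp
    have gv: "g * v \<in> polys_over D" if "g \<in> J'" for g
      using uJ[OF that] unfolding uv by (auto simp: mult.commute simp flip: to_fract_mult)
    \<comment> \<open>Each element of \<open>F\<close> has a power carrying \<open>v\<close> into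
      \<open>D[X]\<close>; as \<open>(D : F)\<close> lies in \<open>D\<close>, these powers can be
      removed.\<close>
    have "coeff v i \<in> D" for i
    proof (rule colon_powers[OF D F colF])
      fix f assume "f \<in> F"
      then obtain g k where gk: "g \<in> J'" "f = coeff g k" by (auto simp: F_def)
      obtain N where "smult (coeff g k ^ N) v \<in> polys_over D"
        using coeff_power_smult[OF D _ gv[OF gk(1)]] gk J'D by blast
      then have "coeff (smult (coeff g k ^ N) v) i \<in> D" unfolding polys_over_def by blast
      then show "\<exists>N. f ^ N * coeff v i \<in> D" using gk by auto
    qed
    then show ?thesis by (simp add: uv to_fract_mem_DX polys_over_def)
  qed
  with J J0 show ?thesis by (auto simp: gv_set_def)
qed

section \<open>The bracket operation\<close>

lemma S1_eq:
  "S1 D st = to_fract ` {s \<in> polys_over (DX D). \<forall>Q\<in>Delta1 D st. s \<notin> polys_over Q}"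
  by (auto simp: S1_def ext_Y_eq)

text \<open>Every element of the span has a denominator \<open>s\<close> in \<open>S\<close>
  carrying it into \<open>E[Y]\<close>; for an element \<open>x\<close> constant in \<open>Y\<close>
  this means that the coefficients of \<open>s\<close> carry \<open>x\<close> into \<open>E\<close>.
  Conversely, a finite \<open>J\<close> is turned into the coefficients of such an
  \<open>s\<close>.\<close>

lemma bracket_iff:
  assumes D: "ss_subring D" and zero: "{0} \<in> Delta1 D st" and E: "ss_submod (DX D) E"
  shows "x \<in> bracket D st E \<longleftrightarrow>
    (\<exists>J. finite J \<and> J \<subseteq> DX D \<and> (\<forall>Q\<in>Delta1 D st. \<not> J \<subseteq> Q) \<and> (\<forall>j\<in>J. j * x \<in> E))"
proof -
  note A = ss_subring_DX[OF D]
  note sA = submod_self[OF A]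
  define S where "S = {s \<in> polys_over (DX D). \<forall>Q\<in>Delta1 D st. s \<notin> polys_over Q}"
  have prime: "ss_prime (DX D) Q" if "Q \<in> Delta1 D st" for Q
    using that by (simp add: Delta1_def)
  have one: "1 \<in> S"
  proof -
    have "1 \<notin> polys_over Q" if "Q \<in> Delta1 D st" for Q
    proof
      assume "1 \<in> polys_over Q"
      then have "coeff 1 0 \<in> Q" unfolding polys_over_def by blast
      then show False
        using prime[OF that] ideal_eq_self_iff[OF A, of Q] by (simp add: ss_prime_def)
    qed
    moreover have "1 \<in> polys_over (DX D)"
      unfolding one_pCons by (rule polys_over_const[OF sA subring_closed(2)[OF A]])
    ultimately show ?thesis by (simp add: S_def)
  qed
  have mult: "s * t \<in> S" if "s \<in> S" "t \<in> S" for s t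
    using that polys_over_mult[OF sA] polys_over_mult_prime[OF A prime] unfolding S_def by blast
  have SA: "S \<subseteq> polys_over (DX D)" by (auto simp: S_def)
  have S0: "s \<noteq> 0" if "s \<in> S" for s
    using that zero by (auto simp: S_def polys_over_def)
  show ?thesis
  proof
    assume "x \<in> bracket D st E"
    then have "emb_Y x \<in> ss_span (R1 D st) (emb_Y ` E)" by (simp add: bracket_def)
    then have "\<exists>s\<in>S. \<exists>h\<in>polys_over E. to_fract s * emb_Y x = to_fract h"
    proof induction
      case zero
      then show ?case using one polys_over_0[OF E] by (intro bexI[of _ 1] bexI[of _ 0]) auto
    next
      case (base e)
      then obtain y where "y \<in> E" "to_fract 1 * e = to_fract [:y:]" by (auto simp: emb_Y_eq)
      then show ?case using one polys_over_const[OF E] by blast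
    next
      case (smult r z)
      then obtain s h where sh: "s \<in> S" "h \<in> polys_over E" "to_fract s * z = to_fract h" by blast
      obtain f t where ft: "r = to_fract f / to_fract t" "f \<in> polys_over (DX D)" "t \<in> S"
        using smult by (auto simp: R1_def ext_Y_eq S1_eq S_def)
      have "to_fract (t * s) * (r * z) = to_fract f * (to_fract s * z)"
        using ft S0 by simp
      also have "\<dots> = to_fract (f * h)" using sh by simp
      finally show ?case using mult[OF ft(3) sh(1)] polys_over_mult[OF E ft(2) sh(2)] by blast
    next
      case (add y z)
      then obtain s h t k where sh: "s \<in> S" "h \<in> polys_over E" "to_fract s * y = to_fract h"
        and tk: "t \<in> S" "k \<in> polys_over E" "to_fract t * z = to_fract k" by blast
      have "to_fract (s * t) * (y + z) = to_fract t * (to_fract s * y) + to_fract s * (to_fract t * z)"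
        by (simp add: algebra_simps)
      also have "\<dots> = to_fract (t * h + s * k)" using sh tk by simp
      finally have "to_fract (s * t) * (y + z) = to_fract (t * h + s * k)" .
      moreover have "t * h + s * k \<in> polys_over E"
        using sh tk SA polys_over_add[OF E] polys_over_mult[OF E] by blast
      ultimately show ?case using mult[OF sh(1) tk(1)] by blast
    qed
    then obtain s h where sh: "s \<in> S" "h \<in> polys_over E" "to_fract s * emb_Y x = to_fract h" by blast
    then have "to_fract (s * [:x:]) = to_fract h" by (simp only: emb_Y_eq to_fract_mult)
    then have "s * [:x:] = h" by (simp only: to_fract_eq_iff)
    then have "smult x s \<in> polys_over E" using sh by simp
    then have "\<forall>j\<in>range (coeff s). j * x \<in> E" by (auto simp: polys_over_def mult.commute)
    moreover have "range (coeff s) \<subseteq> DX D" "\<forall>Q\<in>Delta1 D st. \<not> range (coeff s) \<subseteq> Q"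
      using sh(1) unfolding S_def polys_over_def by blast+
    ultimately show "\<exists>J. finite J \<and> J \<subseteq> DX D \<and> (\<forall>Q\<in>Delta1 D st. \<not> J \<subseteq> Q) \<and> (\<forall>j\<in>J. j * x \<in> E)"
      using finite_range_coeff by (intro exI[of _ "range (coeff s)"] conjI)
  next
    assume "\<exists>J. finite J \<and> J \<subseteq> DX D \<and> (\<forall>Q\<in>Delta1 D st. \<not> J \<subseteq> Q) \<and> (\<forall>j\<in>J. j * x \<in> E)"
    then obtain J where J: "finite J" "J \<subseteq> DX D" "\<forall>j\<in>J. j * x \<in> E" "\<forall>Q\<in>Delta1 D st. \<not> J \<subseteq> Q"
      by auto
    obtain js where js: "set js = J" using J(1) finite_list by blast
    \<comment> \<open>The order of the list is immaterial. Coefficients beyond its length are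
      \<open>0\<close>, which does no harm because \<open>0\<close> lies in \<open>D[X]\<close> and
      in \<open>E\<close>.\<close>
    define s where "s = Poly js"
    have coeff: "coeff s i \<in> J \<union> {0}" for i
      using js by (auto simp: s_def nth_default_def)
    have J_coeff: "\<exists>i. coeff s i = j" if "j \<in> J" for j
      using that js unfolding s_def by (metis coeff_Poly_eq in_set_conv_nth nth_default_nth)
    have "coeff s i \<in> DX D" for i
      using coeff[of i] J(2) subring_closed(1)[OF A] by auto
    then have "s \<in> polys_over (DX D)" by (simp add: polys_over_def)
    moreover have "s \<notin> polys_over Q" if "Q \<in> Delta1 D st" for Q
    proof -
      obtain j where "j \<in> J" "j \<notin> Q" using J(4) \<open>Q \<in> _\<close> by blast
      with J_coeff show ?thesis by (auto simp: polys_over_def)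
    qed
    ultimately have s: "s \<in> S" by (simp add: S_def)
    have sx: "coeff s i * x \<in> E" for i
      using coeff[of i] J(3) E by (auto simp: ss_submod_def)
    have "to_fract [:x:] * to_fract s = to_fract (smult x s)" by (simp flip: to_fract_mult)
    also have "smult x s = (\<Sum>i\<le>degree s. monom (coeff s i * x) i)"
      using poly_as_sum_of_monoms'[OF degree_smult_le[of x s]] by (simp add: mult.commute)
    also have "to_fract \<dots> = (\<Sum>i\<le>degree s. to_fract (monom 1 i) * emb_Y (coeff s i * x))"
      by (simp add: emb_Y_eq smult_monom flip: to_fract_mult)
    \<comment> \<open>Division by \<open>s\<close> writes \<open>x\<close> as a combination of the
      elements \<open>coeff s i * x\<close> of \<open>E\<close> with coefficients
      \<open>Y ^ i / s\<close> from \<open>R1\<close>.\<close>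
    finally have "emb_Y x = (\<Sum>i\<le>degree s. to_fract (monom 1 i) * emb_Y (coeff s i * x)) / to_fract s"
      using S0[OF s] by (simp add: emb_Y_eq field_simps)
    also have "\<dots> = (\<Sum>i\<le>degree s. (to_fract (monom 1 i) / to_fract s) * emb_Y (coeff s i * x))"
      by (simp add: sum_divide_distrib)
    also have "\<dots> \<in> ss_span (R1 D st) (emb_Y ` E)"
    proof (intro ss_span_sum ss_span.smult ss_span.base)
      fix i
      show "emb_Y (coeff s i * x) \<in> emb_Y ` E" using sx by blast
      have "monom 1 i \<in> polys_over (DX D)"
        by (rule polys_over_monom[OF sA subring_closed(2)[OF A]])
      then show "to_fract (monom 1 i) / to_fract s \<in> R1 D st"
        using s by (auto simp: R1_def ext_Y_eq S1_eq S_def)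
    qed
    finally show "x \<in> bracket D st E" by (simp add: bracket_def)
  qed
qed

text \<open>Both sides consist of the \<open>x\<close> that some GV set of \<open>D[X]\<close>
  carries into \<open>E\<close>: the finite sets in \<open>bracket_iff\<close> are exactly the GV
  sets.\<close>

lemma bracket_eq_w:
  assumes D: "ss_subring D" and frac: "\<forall>x. \<exists>a\<in>D. \<exists>b\<in>D. b \<noteq> 0 \<and> x = a / b"
    and E: "ss_nzmod (DX D) E" and st: "Delta1 D st = Delta_gv D"
  shows "bracket D st E = ss_w (DX D) E"
proof -
  note A = ss_subring_DX[OF D]
  have gv: "gv_set (DX D) J \<longleftrightarrow> finite J \<and> J \<subseteq> DX D \<and> (\<forall>Q\<in>Delta_gv D. \<not> J \<subseteq> Q)" for J
  proof
    assume J: "gv_set (DX D) J"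
    then have "finite J" "J \<subseteq> DX D" by (simp_all add: gv_set_def)
    with gv_set_DX_not_subset[OF D frac J]
    show "finite J \<and> J \<subseteq> DX D \<and> (\<forall>Q\<in>Delta_gv D. \<not> J \<subseteq> Q)" by blast
  next
    assume "finite J \<and> J \<subseteq> DX D \<and> (\<forall>Q\<in>Delta_gv D. \<not> J \<subseteq> Q)"
    then show "gv_set (DX D) J" by (intro gv_set_DX_if_not_subset[OF D]) auto
  qed
  have sE: "ss_submod (DX D) E" using E by (simp add: ss_nzmod_def)
  have "x \<in> bracket D st E \<longleftrightarrow> (\<exists>J. gv_set (DX D) J \<and> (\<forall>j\<in>J. j * x \<in> E))" for x
    using bracket_iff[OF D _ sE, of st x] zero_in_Delta_gv[OF D] by (simp add: st gv)
  moreover have "x \<in> ss_w (DX D) E \<longleftrightarrow> (\<exists>J. gv_set (DX D) J \<and> (\<forall>j\<in>J. j * x \<in> E))" for x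
  proof
    assume "x \<in> ss_w (DX D) E"
    then show "\<exists>J. gv_set (DX D) J \<and> (\<forall>j\<in>J. j * x \<in> E)"
      by (rule w_memD[OF A DX_fractions[OF D frac] E])
  qed (auto intro: w_memI[OF A])
  ultimately show ?thesis by (simp add: set_eq_iff)
qed

theorem theorem2p3:
  fixes D :: "'a::field set" and E :: "'a poly fract set"
  assumes "ss_subring D"
    and "\<forall>x. \<exists>a\<in>D. \<exists>b\<in>D. b \<noteq> 0 \<and> x = a / b"
    and "ss_nzmod (DX D) E"
  shows "bracket D (ss_w D) E = bracket D (ss_t D) E
       \<and> bracket D (ss_t D) E = bracket D (ss_v D) E
       \<and> bracket D (ss_v D) E = ss_tilde (DX D) (ss_v (DX D)) E
       \<and> ss_tilde (DX D) (ss_v (DX D)) E = ss_w (DX D) E"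
  using Delta1_eq_Delta_gv[OF assms(1,2)] bracket_eq_w[OF assms] by (simp add: ss_w_def)

end
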